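(* Assume that $A$ is $(\mathcal{B}(\mathbb{R})\otimes\mathcal{B}(V)\otimes\mathcal{F},\mathcal{B}(V^* ))$-measurable, strictly stationary (i.e. $A(t,v;\omega)=A(0,v;\theta_t\omega)$) and satisfies (A1)–(A4). Moreover, assume that there are a function $\lambda:\Omega\to\mathbb{R}_+\setminus\{0\}$ and a number $0<p<2$ such that $${}_{V^*}\langle A(t,v;\omega),v\rangle_V\le-\lambda(\omega)\|v\|_H^p\quad\text{for all }t\in\mathbb{R},\ v\in V,\ \omega\in\Omega.$$ Then $\mathcal{A}(\omega):=\{0\}$ is forward-absorbing in the sense that for $\mathbb{P}$-almost every $\omega\in\Omega$, every bounded set $B\subseteq H$ and every $s\in\mathbb{R}$ there is an absorption time $t_0=t_0(\|B\|_H,s,\omega)$ such that $S(t,s;\omega)B\subseteq\{0\}$ for all $t\ge t_0$ (for $s=0$: $\varphi(t,\omega)B\subseteq\{0\}$ for all $t\ge t_0$). If $A(t,0;\omega)=0$ for all $t\in\mathbb{R}$, $\omega\in\Omega$, then $\mathcal{A}$ is invariant under $\varphi$, and thus $\mathcal{A}$ is a forward attractor for $\varphi$.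
   Context: Setting. $V\subseteq H\equiv H^*\subseteq V^*$ is a Gelfand triple: $H$ is a separable Hilbert space identified with its dual by the Riesz isomorphism, $V$ is a reflexive Banach space continuously and densely embedded into $H$, and ${}_{V^*}\langle\cdot,\cdot\rangle_V$ is the duality pairing. $(\Omega,\mathcal{F},\mathbb{P},\{\theta_t\}_{t\in\mathbb{R}})$ is the metric dynamical system associated to two-sided real-valued Brownian motion $\beta$ (canonical Wiener space of continuous paths vanishing at $0$, with the Wiener shift $\theta_t\omega=\omega(t+\cdot)-\omega(t)$ and $\beta_t(\omega)=\omega(t)$). $\mu\in\mathbb{R}$. Drift. $A:\mathbb{R}\times V\times\Omega\to V^*$ is such that $A(\cdot,\cdot;\omega)$ is $(\mathcal{B}(\mathbb{R})\otimes\mathcal{B}(V),\mathcal{B}(V^* ))$-measurable for each $\omega$; $A$ is extended by $0$ to all of $H$. There are pathwise right-continuous mappings $C_1,C_2:\mathbb{R}\times\Omega\to\mathbb{R}$, $c:\mathbb{R}\times\Omega\to\mathbb{R}_+\setminus\{0\}$, a number $\alpha\in(1,2)$, and $f:\mathbb{R}\times\Omega\to\mathbb{R}$ with $f(\cdot,\omega)\in L^1_{loc}(\mathbb{R})$, such that for all $v,v_1,v_2\in V$, $t\in\mathbb{R}$, $\omega\in\Omega$: (A1) $s\mapsto{}_{V^*}\langle A(t,v_1+sv_2;\omega),v\rangle_V$ is continuous on $\mathbb{R}$; (A2) $2\,{}_{V^*}\langle A(t,v_1;\omega)-A(t,v_2;\omega),v_1-v_2\rangle_V\le C_2(t,\omega)\|v_1-v_2\|_H^2$;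 (A3) $2\,{}_{V^*}\langle A(t,v;\omega),v\rangle_V\le C_1(t,\omega)\|v\|_H^2-c(t,\omega)\|v\|_V^\alpha+f(t,\omega)$; (A4) $\|A(t,v;\omega)\|_{V^*}^{\frac{\alpha}{\alpha-1}}\le C_1(t,\omega)\|v\|_H^2+C_2(t,\omega)\|v\|_V^\alpha+f(t,\omega)$. Flow associated to the Stratonovich equation $dX_t=A(t,X_t)dt+\mu X_t\circ d\beta_t$. Put $\mu_t:=e^{-\mu\beta_t}$ and $A_\omega(r,v):=\mu_r(\omega)A(r,\mu_r^{-1}(\omega)v;\omega)$. For $s\in\mathbb{R}$, $x\in H$, let $Z(\cdot,s;\omega)x\in L^\alpha_{loc}([s,\infty);V)\cap C([s,\infty);H)$ be the unique solution of $Z(t,s;\omega)x=x+\int_s^tA_\omega(r,Z(r,s;\omega)x)\,dr$, $t\ge s$ (in $V^*$; unique existence holds under (A1)–(A4)). Define $S(t,s;\omega)x:=\mu_t^{-1}(\omega)Z(t,s;\omega)(\mu_s(\omega)x)$ and $\varphi(t,\omega):=S(t,0;\omega)$; under the stated assumptions $\varphi$ is a continuous RDS and $S(t,s;\omega)=\varphi(t-s,\theta_s\omega)$. For $B\subseteq H$, $\|B\|_H:=\sup_{b\in B}\|b\|_H$. $\mathcal{A}$ is invariant under $\varphi$ if $\varphi(t,\omega)\mathcal{A}(\omega)=\mathcal{A}(\theta_t\omega)$ for all $t\ge0$. A forward attractor is an invariant random compact set $\mathcal{A}$ such that, $\mathbb{P}$-a.s., $\sup_{b\in B}d(\varphi(t,\omega)b,\mathcal{A}(\theta_t\omega))\to0$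 as $t\to\infty$ for every bounded $B\subseteq H$. *)

theory Defs
  imports "HOL-Probability.Probability"
begin

definition reflexive_space :: "'v::real_normed_vector itself \<Rightarrow> bool" where
  "reflexive_space _ \<longleftrightarrow>
     (\<forall>F :: ('v \<Rightarrow>\<^sub>L real) \<Rightarrow>\<^sub>L real. \<exists>v::'v. \<forall>g. blinfun_apply F g = blinfun_apply g v)"

text \<open>
  The embedding of V into H is an explicit map j. The dual of V is carried by a type 'w of its own,
  identified with the space of bounded functionals on V by the isometric isomorphism D, so that
  D w v is the duality pairing of w and v. The reason is that the library's Bochner integral needs
  a second countable range type, and the type of bounded functionals is not declared as one.
  The sort second_countable_topology of 'v and 'w is no restriction: as V is reflexive and j is
  injective, the adjoint of j maps the separable space H onto a dense subspace of the dual of V;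
  so that dual is separable, and hence V is.
\<close>

definition gelfand_triple ::
  "('v::{banach,second_countable_topology} \<Rightarrow> 'h::{real_inner,banach,second_countable_topology})
     \<Rightarrow> ('w::{banach,second_countable_topology} \<Rightarrow> ('v \<Rightarrow>\<^sub>L real)) \<Rightarrow> bool" where
  "gelfand_triple j D \<longleftrightarrow>
     reflexive_space TYPE('v) \<and>
     bounded_linear j \<and> inj j \<and> closure (range j) = UNIV \<and>
     linear D \<and> (\<forall>w. norm (D w) = norm w) \<and> surj D"

text \<open>The embedding of H (identified with its dual by Riesz) into the dual of V.\<close>

definition H_in_dual ::
  "('v::real_normed_vector \<Rightarrow> 'h::real_inner) \<Rightarrow> ('w \<Rightarrow> ('v \<Rightarrow>\<^sub>L real)) \<Rightarrow> 'h \<Rightarrow> 'w" where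
  "H_in_dual j D h = inv D (Blinfun (\<lambda>v. inner h (j v)))"

definition extend_by_zero :: "('v \<Rightarrow> 'h) \<Rightarrow> ('v \<Rightarrow> 'w::zero) \<Rightarrow> 'h \<Rightarrow> 'w" where
  "extend_by_zero j a h = (if h \<in> range j then a (inv j h) else 0)"

type_synonym path = "real \<Rightarrow> real"

definition wiener_paths :: "path set" where
  "wiener_paths = {\<omega>. continuous_on UNIV \<omega> \<and> \<omega> 0 = 0}"

definition wiener_shift :: "real \<Rightarrow> path \<Rightarrow> path" where
  "wiener_shift t \<omega> = (\<lambda>r. \<omega> (t + r) - \<omega> t)"

text \<open>
  The measure P is determined by this predicate. Times range over the whole real line, so the
  increments before and after time 0 are independent as well.
\<close>

definition two_sided_wiener_space :: "path measure \<Rightarrow> bool" where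
  "two_sided_wiener_space P \<longleftrightarrow>
     prob_space P \<and>
     space P = wiener_paths \<and>
     sets P = sets (restrict_space (PiM UNIV (\<lambda>_. borel)) wiener_paths) \<and>
     (\<forall>s t. s < t \<longrightarrow>
        distributed P lborel (\<lambda>\<omega>. \<omega> t - \<omega> s) (normal_density 0 (sqrt (t - s)))) \<and>
     (\<forall>(n::nat) (\<tau> :: nat \<Rightarrow> real). strict_mono \<tau> \<longrightarrow>
        prob_space.indep_vars P (\<lambda>_. borel) (\<lambda>i \<omega>. \<omega> (\<tau> (Suc i)) - \<omega> (\<tau> i)) {..<n})"

definition right_continuous :: "(real \<Rightarrow> real) \<Rightarrow> bool" where
  "right_continuous g \<longleftrightarrow> (\<forall>t. continuous (at_right t) g)"

definition L1_loc :: "(real \<Rightarrow> real) \<Rightarrow> bool" where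
  "L1_loc g \<longleftrightarrow> (\<forall>a b. set_integrable lebesgue {a..b} g)"

definition condition_A1 ::
  "('w \<Rightarrow> ('v::real_normed_vector \<Rightarrow>\<^sub>L real)) \<Rightarrow> (real \<Rightarrow> 'v \<Rightarrow> path \<Rightarrow> 'w) \<Rightarrow> bool" where
  "condition_A1 D A \<longleftrightarrow> (\<forall>v v1 v2 t. \<forall>\<omega>\<in>wiener_paths.
     continuous_on UNIV (\<lambda>s::real. D (A t (v1 + s *\<^sub>R v2) \<omega>) v))"

definition condition_A2 ::
  "('v::real_normed_vector \<Rightarrow> 'h::real_normed_vector) \<Rightarrow> ('w::ab_group_add \<Rightarrow> ('v \<Rightarrow>\<^sub>L real))
     \<Rightarrow> (real \<Rightarrow> 'v \<Rightarrow> path \<Rightarrow> 'w) \<Rightarrow> (real \<Rightarrow> path \<Rightarrow> real) \<Rightarrow> bool" where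
  "condition_A2 j D A C2 \<longleftrightarrow> (\<forall>v1 v2 t. \<forall>\<omega>\<in>wiener_paths.
     2 * D (A t v1 \<omega> - A t v2 \<omega>) (v1 - v2) \<le> C2 t \<omega> * norm (j v1 - j v2) ^ 2)"

definition condition_A3 ::
  "('v::real_normed_vector \<Rightarrow> 'h::real_normed_vector) \<Rightarrow> ('w \<Rightarrow> ('v \<Rightarrow>\<^sub>L real))
     \<Rightarrow> (real \<Rightarrow> 'v \<Rightarrow> path \<Rightarrow> 'w) \<Rightarrow> real
     \<Rightarrow> (real \<Rightarrow> path \<Rightarrow> real) \<Rightarrow> (real \<Rightarrow> path \<Rightarrow> real) \<Rightarrow> (real \<Rightarrow> path \<Rightarrow> real) \<Rightarrow> bool" where
  "condition_A3 j D A \<alpha> C1 c f \<longleftrightarrow> (\<forall>v t. \<forall>\<omega>\<in>wiener_paths.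
     2 * D (A t v \<omega>) v \<le> C1 t \<omega> * norm (j v) ^ 2 - c t \<omega> * norm v powr \<alpha> + f t \<omega>)"

definition condition_A4 ::
  "('v::real_normed_vector \<Rightarrow> 'h::real_normed_vector)
     \<Rightarrow> (real \<Rightarrow> 'v \<Rightarrow> path \<Rightarrow> 'w::real_normed_vector) \<Rightarrow> real
     \<Rightarrow> (real \<Rightarrow> path \<Rightarrow> real) \<Rightarrow> (real \<Rightarrow> path \<Rightarrow> real) \<Rightarrow> (real \<Rightarrow> path \<Rightarrow> real) \<Rightarrow> bool" where
  "condition_A4 j A \<alpha> C1 C2 f \<longleftrightarrow> (\<forall>v t. \<forall>\<omega>\<in>wiener_paths.
     norm (A t v \<omega>) powr (\<alpha> / (\<alpha> - 1))
       \<le> C1 t \<omega> * norm (j v) ^ 2 + C2 t \<omega> * norm v powr \<alpha> + f t \<omega>)"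

definition strictly_stationary :: "(real \<Rightarrow> 'v \<Rightarrow> path \<Rightarrow> 'w) \<Rightarrow> bool" where
  "strictly_stationary A \<longleftrightarrow>
     (\<forall>t v. \<forall>\<omega>\<in>wiener_paths. A t v \<omega> = A 0 v (wiener_shift t \<omega>))"

definition noise_factor :: "real \<Rightarrow> path \<Rightarrow> real \<Rightarrow> real" where
  "noise_factor \<mu> \<omega> t = exp (- \<mu> * \<omega> t)"

definition transformed_drift ::
  "('v \<Rightarrow> 'h::real_vector) \<Rightarrow> real \<Rightarrow> (real \<Rightarrow> 'v \<Rightarrow> path \<Rightarrow> 'w::real_vector)
     \<Rightarrow> path \<Rightarrow> real \<Rightarrow> 'h \<Rightarrow> 'w" where
  "transformed_drift j \<mu> A \<omega> r h =
     noise_factor \<mu> \<omega> r *\<^sub>R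
       extend_by_zero j (\<lambda>v. A r v \<omega>) (inverse (noise_factor \<mu> \<omega> r) *\<^sub>R h)"

definition L_loc :: "real \<Rightarrow> real \<Rightarrow> (real \<Rightarrow> 'v::{banach,second_countable_topology}) set" where
  "L_loc \<alpha> s = {v. set_borel_measurable lebesgue {s..} v \<and>
     (\<forall>T. set_integrable lebesgue {s..T} (\<lambda>r. norm (v r) powr \<alpha>))}"

definition is_solution ::
  "('v::{banach,second_countable_topology} \<Rightarrow> 'h::{real_inner,banach,second_countable_topology})
     \<Rightarrow> ('w::{banach,second_countable_topology} \<Rightarrow> ('v \<Rightarrow>\<^sub>L real))
     \<Rightarrow> real \<Rightarrow> real \<Rightarrow> (real \<Rightarrow> 'v \<Rightarrow> path \<Rightarrow> 'w) \<Rightarrow> path \<Rightarrow> real \<Rightarrow> 'h \<Rightarrow> (real \<Rightarrow> 'h) \<Rightarrow> bool" where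
  "is_solution j D \<alpha> \<mu> A \<omega> s x z \<longleftrightarrow>
     continuous_on {s..} z \<and>
     (\<exists>v\<in>L_loc \<alpha> s. AE r in lebesgue. s \<le> r \<longrightarrow> z r = j (v r)) \<and>
     (\<forall>t\<ge>s. set_integrable lebesgue {s..t} (\<lambda>r. transformed_drift j \<mu> A \<omega> r (z r)) \<and>
        H_in_dual j D (z t) =
          H_in_dual j D x + (LINT r:{s..t}|lebesgue. transformed_drift j \<mu> A \<omega> r (z r)))"

text \<open>
  Z t s \<omega> x is the value at time t of the solution started in x at time s. Solutions are unique
  on the interval from s to infinity by condition A2 (together with A4 and right-continuity of the
  coefficients), so uniqueness is not made part of the predicate.
\<close>

definition solution_family ::
  "('v::{banach,second_countable_topology} \<Rightarrow> 'h::{real_inner,banach,second_countable_topology})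
     \<Rightarrow> ('w::{banach,second_countable_topology} \<Rightarrow> ('v \<Rightarrow>\<^sub>L real))
     \<Rightarrow> real \<Rightarrow> real \<Rightarrow> (real \<Rightarrow> 'v \<Rightarrow> path \<Rightarrow> 'w)
     \<Rightarrow> (real \<Rightarrow> real \<Rightarrow> path \<Rightarrow> 'h \<Rightarrow> 'h) \<Rightarrow> bool" where
  "solution_family j D \<alpha> \<mu> A Z \<longleftrightarrow>
     (\<forall>s x. \<forall>\<omega>\<in>wiener_paths. is_solution j D \<alpha> \<mu> A \<omega> s x (\<lambda>t. Z t s \<omega> x))"

definition stoch_flow ::
  "real \<Rightarrow> (real \<Rightarrow> real \<Rightarrow> path \<Rightarrow> 'h \<Rightarrow> 'h) \<Rightarrow> real \<Rightarrow> real \<Rightarrow> path \<Rightarrow> 'h::real_vector \<Rightarrow> 'h" where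
  "stoch_flow \<mu> Z t s \<omega> x =
     inverse (noise_factor \<mu> \<omega> t) *\<^sub>R Z t s \<omega> (noise_factor \<mu> \<omega> s *\<^sub>R x)"

definition cocycle ::
  "real \<Rightarrow> (real \<Rightarrow> real \<Rightarrow> path \<Rightarrow> 'h \<Rightarrow> 'h) \<Rightarrow> real \<Rightarrow> path \<Rightarrow> 'h::real_vector \<Rightarrow> 'h" where
  "cocycle \<mu> Z t \<omega> = stoch_flow \<mu> Z t 0 \<omega>"

text \<open>For the empty set the value is unspecified.\<close>

definition set_norm :: "'h::real_normed_vector set \<Rightarrow> real" where
  "set_norm B = (SUP b\<in>B. norm b)"

definition random_compact_set :: "'o measure \<Rightarrow> ('o \<Rightarrow> 'h::metric_space set) \<Rightarrow> bool" where
  "random_compact_set P K \<longleftrightarrow>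
     (\<forall>\<omega>\<in>space P. compact (K \<omega>) \<and> K \<omega> \<noteq> {}) \<and>
     (\<forall>x. (\<lambda>\<omega>. infdist x (K \<omega>)) \<in> borel_measurable P)"

definition invariant_under ::
  "'o measure \<Rightarrow> (real \<Rightarrow> 'o \<Rightarrow> 'o) \<Rightarrow> (real \<Rightarrow> 'o \<Rightarrow> 'h \<Rightarrow> 'h) \<Rightarrow> ('o \<Rightarrow> 'h set) \<Rightarrow> bool" where
  "invariant_under P \<theta> \<phi> K \<longleftrightarrow> (\<forall>\<omega>\<in>space P. \<forall>t\<ge>0. \<phi> t \<omega> ` K \<omega> = K (\<theta> t \<omega>))"

text \<open>The supremum is taken in the extended nonnegative reals, where the empty supremum is 0.\<close>

definition forward_attractor ::
  "'o measure \<Rightarrow> (real \<Rightarrow> 'o \<Rightarrow> 'o) \<Rightarrow> (real \<Rightarrow> 'o \<Rightarrow> 'h \<Rightarrow> 'h)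
     \<Rightarrow> ('o \<Rightarrow> 'h::metric_space set) \<Rightarrow> bool" where
  "forward_attractor P \<theta> \<phi> K \<longleftrightarrow>
     random_compact_set P K \<and>
     invariant_under P \<theta> \<phi> K \<and>
     (AE \<omega> in P. \<forall>B. bounded B \<longrightarrow>
        ((\<lambda>t. SUP b\<in>B. ennreal (infdist (\<phi> t \<omega> b) (K (\<theta> t \<omega>)))) \<longlongrightarrow> 0) at_top)"

end

theory Submission
  imports Defs
begin

text \<open>
  Why bounded sets are absorbed in finite time. Let \<open>z\<close> be a solution of the transformed equation
  and \<open>y r = norm (z r) ^ 2\<close>. The transformed drift at \<open>r\<close>, paired with \<open>z r\<close>, is at
  most \<open>- l \<omega> * exp ((p - 2) * \<mu> * \<omega> r) * norm (z r) powr p\<close>, so formally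

  \<open>y' \<le> - 2 * l \<omega> * exp ((p - 2) * \<mu> * \<omega> r) * y powr (p / 2)\<close>.

  The exponent \<open>p / 2\<close> is less than \<open>1\<close>, hence \<open>y powr (1 - p / 2)\<close> decreases at least
  at the rate \<open>(2 - p) * l \<omega> * exp ((p - 2) * \<mu> * \<omega> r)\<close> until it hits zero, and \<open>y\<close>
  stays there because it is decreasing. Zero is reached as soon as the integral of this rate exceeds
  \<open>norm (z s) powr (2 - p)\<close>, a time that depends on the initial value only through its norm. That
  the integral diverges for almost every path is a property of Brownian motion.

  The differential inequality is justified by \<open>energy_inequality\<close>: the chain rule for the square of the
  norm, for functions that are differentiable only in the dual space. Since only an inequality is
  wanted, backward differences of the solution itself can be used. The inequality requires the drift to
  lie in the conjugate Lebesgue space. The growth condition yields this only where its coefficients are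
  bounded, and right-continuous coefficients are bounded merely on short
  intervals to the right of each time. \<open>solution_energy_decay\<close> passes from such intervals to all
  times by continuous induction.

  The comparison with the ordinary differential inequality is \<open>finite_time_extinction\<close>.

  The divergence of the exponential functional is \<open>wiener_exponential_functional_diverges\<close>. It
  rests on independent Gaussian increments and continuity of the paths: along very fast growing times the
  sign of the path is determined by its last increment, so it has a prescribed sign infinitely often;
  Fubini's theorem turns this statement about single times into one about the integral.

  A solution that starts at zero stays at zero by the same decay of the norm. This gives the invariance
  of \<open>{0}\<close>, and forward attraction is a special case of absorption.
\<close>

section \<open>Backward averages of integrable functions\<close>

text \<open>
The integrals over the two windows of length \<open>h\<close> at the end points are all that survives when
\<open>y t - y (t - h)\<close> is integrated, because the two translates overlap in between. Divided by
\<open>h\<close>, the right hand side tends to \<open>y b - y a\<close> for continuous \<open>y\<close>: this is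
how differences of values are recovered from an inequality that holds only almost everywhere.
\<close>

lemma integral_backward_difference:
  fixes y :: "real \<Rightarrow> real"
  assumes y: "continuous_on {a - h..b} y" and h: "0 \<le> h" and ab: "a \<le> b"
  shows "(\<lambda>t. y t - y (t - h)) integrable_on {a..b}"
    and "integral {a..b} (\<lambda>t. y t - y (t - h)) = integral {b - h..b} y - integral {a - h..a} y"
proof -
  have I: "y integrable_on {c..d}" if "a - h \<le> c" "d \<le> b" for c d
    using that by (intro integrable_continuous_real continuous_on_subset[OF y]) auto
  have S: "((\<lambda>t. y (t - h)) has_integral integral {a - h..b - h} y) {a..b}"
    using has_integral_shift_Icc_real[of y "- h" "integral {a - h..b - h} y" a b] I[of "a - h" "b - h"] h
    by (simp add: o_def integrable_integral)
  have D: "((\<lambda>t. y t - y (t - h)) has_integral (integral {a..b} y - integral {a - h..b - h} y)) {a..b}"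
    using S I[of a b] h by (intro has_integral_diff) (auto simp: integrable_integral)
  have "integral {a - h..a} y + integral {a..b} y = integral {a - h..b} y"
       "integral {a - h..b - h} y + integral {b - h..b} y = integral {a - h..b} y"
    using h ab by (auto intro!: Henstock_Kurzweil_Integration.integral_combine I)
  with D show "(\<lambda>t. y t - y (t - h)) integrable_on {a..b}"
    "integral {a..b} (\<lambda>t. y t - y (t - h)) = integral {b - h..b} y - integral {a - h..a} y"
    by (auto simp: integral_unique integrable_on_def)
qed

lemma absolutely_integrable_abs_diff:
  fixes f g :: "real \<Rightarrow> real"
  assumes "f absolutely_integrable_on S" "g absolutely_integrable_on S"
  shows "(\<lambda>t. \<bar>f t - g t\<bar>) integrable_on S"
  using set_integral_diff(1)[OF assms] by (simp add: absolutely_integrable_on_def)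

lemma integral_as_primitive_difference:
  fixes g :: "real \<Rightarrow> real"
  assumes g: "g integrable_on {c..d}" and "c \<le> r" "r \<le> t" "t \<le> d"
  shows "integral {r..t} g = integral {c..t} g - integral {c..r} g"
  using Henstock_Kurzweil_Integration.integral_combine[where f = g and a = c and c = r and b = t] integrable_subinterval_real[OF g, of c t] assms by auto

lemma continuous_on_backward_integral:
  fixes g :: "real \<Rightarrow> real"
  assumes g: "g integrable_on {c..d}" and h: "0 \<le> h" "c \<le> a - h" and "b \<le> d"
  shows "continuous_on {a..b} (\<lambda>t. integral {t - h..t} g)"
proof -
  have G: "continuous_on {a - h..b} (\<lambda>t. integral {c..t} g)"
    by (rule continuous_on_subset[OF indefinite_integral_continuous_1[OF g]]) (use assms in auto)
  have "continuous_on {a..b} (\<lambda>t. integral {c..t} g - integral {c..t - h} g)"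
  proof (rule continuous_on_diff)
    show "continuous_on {a..b} (\<lambda>t. integral {c..t} g)"
      by (rule continuous_on_subset[OF G]) (use h in auto)
    show "continuous_on {a..b} (\<lambda>t. integral {c..t - h} g)"
      by (rule continuous_on_compose2[OF G]) (use h in \<open>auto intro!: continuous_intros\<close>)
  qed
  then show ?thesis
    by (rule continuous_on_eq)
      (use assms in \<open>auto intro!: integral_as_primitive_difference[OF g, symmetric]\<close>)
qed

text \<open>
Averaging over backward windows does not increase the \<open>L\<^sup>1\<close> norm. With the primitive \<open>G\<close>
of \<open>g\<close> the integrand is \<open>G t - G (t - h)\<close>; its integral telescopes to a window of
length \<open>h\<close>, on which the increasing function \<open>G\<close> is at most \<open>G d\<close>. This replaces
an exchange of the order of integration.
\<close>

lemma backward_integral_le: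
  fixes g :: "real \<Rightarrow> real"
  assumes g: "g integrable_on {c..d}" and nonneg: "\<And>t. 0 \<le> g t"
    and h: "0 \<le> h" "c \<le> a - h" and ab: "a \<le> b" "b \<le> d"
  shows "integral {a..b} (\<lambda>t. integral {t - h..t} g) \<le> h * integral {c..d} g"
proof -
  define G where "G = (\<lambda>t. integral {c..t} g)"
  have I: "g integrable_on {c..t}" if "t \<le> d" for t
    using that by (intro integrable_subinterval_real[OF g]) auto
  have G: "0 \<le> G t" "G t \<le> G d" if "t \<le> d" for t
    unfolding G_def using that nonneg by (auto intro!: integral_nonneg integral_subset_le I)
  have cont: "continuous_on {a - h..b} G"
    unfolding G_def
    by (rule continuous_on_subset[OF indefinite_integral_continuous_1[OF g]]) (use assms in auto)
  have GI: "G integrable_on {r..t}" if "a - h \<le> r" "t \<le> b" for r t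
    using that by (intro integrable_continuous_real continuous_on_subset[OF cont]) auto
  have "integral {a..b} (\<lambda>t. integral {t - h..t} g) = integral {a..b} (\<lambda>t. G t - G (t - h))"
    unfolding G_def
    by (rule integral_cong) (use assms in \<open>auto intro!: integral_as_primitive_difference[OF g]\<close>)
  also have "\<dots> = integral {b - h..b} G - integral {a - h..a} G"
    by (rule integral_backward_difference(2)[OF cont h(1) ab(1)])
  also have "\<dots> \<le> integral {b - h..b} (\<lambda>t. G d) - 0"
    using assms by (intro diff_mono integral_le integral_nonneg GI G) auto
  finally show ?thesis using h by (simp add: G_def)
qed

lemma continuous_backward_average:
  fixes y :: "real \<Rightarrow> real"
  assumes y: "continuous_on {c..d} y" and e: "0 < e"
  shows "\<forall>\<^sub>F h in at_right 0. \<forall>t. c \<le> t - h \<and> t \<le> d \<longrightarrow>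
           \<bar>integral {t - h..t} y - h * y t\<bar> \<le> e * h"
proof -
  have "uniformly_continuous_on {c..d} y"
    using y by (rule compact_uniformly_continuous) simp
  then obtain \<delta> where \<delta>: "0 < \<delta>"
    and close: "\<And>r t. r \<in> {c..d} \<Longrightarrow> t \<in> {c..d} \<Longrightarrow> dist r t < \<delta> \<Longrightarrow> dist (y r) (y t) < e"
    unfolding uniformly_continuous_on_def using e by metis
  have "\<bar>integral {t - h..t} y - h * y t\<bar> \<le> e * h"
    if t: "0 < h" "h < \<delta>" "c \<le> t - h" "t \<le> d" for h t
  proof -
    have I: "y integrable_on {t - h..t}"
      by (intro integrable_continuous_real continuous_on_subset[OF y]) (use t in auto)
    have "integral {t - h..t} y - h * y t = integral {t - h..t} (\<lambda>r. y r - y t)"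
      using I t by (subst integral_diff) auto
    also have "norm \<dots> \<le> integral {t - h..t} (\<lambda>r. e)"
    proof (rule integral_norm_bound_integral)
      fix r assume "r \<in> {t - h..t}"
      then show "norm (y r - y t) \<le> e"
        using close[of r t] t by (auto simp: dist_real_def)
    qed (use I in \<open>auto intro!: integrable_diff\<close>)
    also have "\<dots> = e * h" using t by simp
    finally show ?thesis by simp
  qed
  with \<delta> show ?thesis unfolding eventually_at_right_field by blast
qed

text \<open>
Density of the continuous functions in \<open>L\<^sup>1\<close>. A Lebesgue measurable function is an almost
everywhere limit of continuous functions, but without a common bound. Cutting the values off at
level \<open>n\<close> keeps the approximants continuous and supplies the bound for dominated convergence;
the cut-off of \<open>g\<close> itself is controlled by \<open>\<bar>g\<bar>\<close>.
\<close>

lemma absolutely_integrable_approx_continuous: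
  fixes g :: "real \<Rightarrow> real"
  assumes g: "g absolutely_integrable_on {c..d}" and e: "0 < e"
  obtains k where "continuous_on UNIV k" "integral {c..d} (\<lambda>t. \<bar>g t - k t\<bar>) < e"
proof -
  define clamp where "clamp = (\<lambda>(n::nat) (x::real). max (- real n) (min (real n) x))"
  have clamp_tendsto: "(\<lambda>n. clamp n x) \<longlonglongrightarrow> x" for x
  proof (rule tendsto_eventually)
    obtain N :: nat where "\<bar>x\<bar> \<le> real N" using real_arch_simple by blast
    then have "clamp n x = x" if "N \<le> n" for n
      using that by (auto simp: clamp_def max_def min_def)
    then show "\<forall>\<^sub>F n in sequentially. clamp n x = x"
      by (auto simp: eventually_sequentially)
  qed
  have clamp_cont: "continuous_on UNIV (clamp n)" for n
    unfolding clamp_def by (intro continuous_intros)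
  have clamp_le: "\<bar>clamp n x\<bar> \<le> \<bar>x\<bar>" "\<bar>clamp n x\<bar> \<le> real n" for n x
    by (auto simp: clamp_def)
  have meas: "g \<in> borel_measurable (lebesgue_on {c..d})"
    using g by (rule absolutely_integrable_measurable[THEN iffD1, THEN conjunct1, rotated]) simp
  define F where "F = (\<lambda>x. if x \<in> {c..d} then g x else 0)"
  have "F \<in> borel_measurable lebesgue"
    unfolding F_def using meas by (subst borel_measurable_if) auto
  then have "F measurable_on UNIV"
    by (rule lebesgue_measurable_imp_measurable_on_real) (use sets.top[of lebesgue] in simp)
  then obtain N k where N: "negligible N" and k: "\<And>n. continuous_on UNIV (k n)"
    and lim: "\<And>x. x \<notin> N \<Longrightarrow> (\<lambda>n. k n x) \<longlonglongrightarrow> F x"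
    unfolding measurable_on_def by auto
  have cl_int: "(\<lambda>t. clamp n (g t)) absolutely_integrable_on {c..d}" for n
  proof (rule measurable_bounded_by_integrable_imp_absolutely_integrable)
    show "(\<lambda>t. clamp n (g t)) \<in> borel_measurable (lebesgue_on {c..d})"
      using meas borel_measurable_continuous_onI[OF clamp_cont] by (rule measurable_compose)
    show "(\<lambda>t. norm (g t)) integrable_on {c..d}"
      using g by (simp add: absolutely_integrable_on_def)
  qed (use clamp_le in auto)
  have absint: "(\<lambda>t. \<bar>g t - clamp n (g t)\<bar>) integrable_on {c..d}" for n
    by (rule absolutely_integrable_abs_diff[OF g cl_int])
  have "(\<lambda>n. integral {c..d} (\<lambda>t. \<bar>g t - clamp n (g t)\<bar>)) \<longlonglongrightarrow> integral {c..d} (\<lambda>t. 0)"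
  proof (rule dominated_convergence(2))
    show "(\<lambda>t. 2 * \<bar>g t\<bar>) integrable_on {c..d}"
      using g by (auto simp: absolutely_integrable_on_def)
    show "norm \<bar>g t - clamp n (g t)\<bar> \<le> 2 * \<bar>g t\<bar>" for n t
      using clamp_le(1)[of n "g t"] by simp
    show "(\<lambda>n. \<bar>g t - clamp n (g t)\<bar>) \<longlonglongrightarrow> 0" for t
      using tendsto_rabs[OF tendsto_diff[OF tendsto_const[of "g t"] clamp_tendsto[of "g t"]]] by simp
  qed (rule absint)
  then have "\<forall>\<^sub>F n in sequentially. integral {c..d} (\<lambda>t. \<bar>g t - clamp n (g t)\<bar>) < e / 2"
    using e by (intro order_tendstoD) auto
  then obtain n where n: "integral {c..d} (\<lambda>t. \<bar>g t - clamp n (g t)\<bar>) < e / 2"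
    by (auto simp: eventually_sequentially)
  have kc: "continuous_on UNIV (\<lambda>t. clamp n (k m t))" for m
    using continuous_on_compose2[OF clamp_cont k] by simp
  have kint: "(\<lambda>t. clamp n (k m t)) absolutely_integrable_on {c..d}" for m
    using continuous_on_subset[OF kc] by (intro absolutely_integrable_continuous_real) auto
  have absint2: "(\<lambda>t. \<bar>clamp n (g t) - clamp n (k m t)\<bar>) integrable_on {c..d}" for m
    by (rule absolutely_integrable_abs_diff[OF cl_int kint])
  have sp: "integral {c..d} f = integral ({c..d} - N) f" for f :: "real \<Rightarrow> real"
    by (rule integral_spike_set) (rule negligible_subset[OF N], blast)+
  have spi: "f integrable_on {c..d} - N \<longleftrightarrow> f integrable_on {c..d}" for f :: "real \<Rightarrow> real"
    by (rule integrable_spike_set_eq) (rule negligible_subset[OF N], blast)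
  have "(\<lambda>m. integral ({c..d} - N) (\<lambda>t. \<bar>clamp n (g t) - clamp n (k m t)\<bar>))
          \<longlonglongrightarrow> integral ({c..d} - N) (\<lambda>t. 0)"
  proof (rule dominated_convergence(2))
    show "(\<lambda>t. 2 * real n) integrable_on {c..d} - N"
      unfolding spi by (rule integrable_const_ivl)
    show "(\<lambda>t. \<bar>clamp n (g t) - clamp n (k m t)\<bar>) integrable_on {c..d} - N" for m
      by (simp add: spi absint2)
    show "norm \<bar>clamp n (g t) - clamp n (k m t)\<bar> \<le> 2 * real n" for m t
      using clamp_le(2)[of n "g t"] clamp_le(2)[of n "k m t"] by simp
    show "(\<lambda>m. \<bar>clamp n (g t) - clamp n (k m t)\<bar>) \<longlonglongrightarrow> 0" if t: "t \<in> {c..d} - N" for t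
    proof -
      have "(\<lambda>m. k m t) \<longlonglongrightarrow> g t" using lim[of t] t by (simp add: F_def)
      then have "(\<lambda>m. clamp n (k m t)) \<longlonglongrightarrow> clamp n (g t)"
        using clamp_cont by (intro continuous_on_tendsto_compose[of UNIV "clamp n"]) auto
      from tendsto_rabs[OF tendsto_diff[OF tendsto_const[of "clamp n (g t)"] this]] show ?thesis by simp
    qed
  qed
  then have "(\<lambda>m. integral {c..d} (\<lambda>t. \<bar>clamp n (g t) - clamp n (k m t)\<bar>)) \<longlonglongrightarrow> 0"
    by (simp flip: sp)
  then have "\<forall>\<^sub>F m in sequentially. integral {c..d} (\<lambda>t. \<bar>clamp n (g t) - clamp n (k m t)\<bar>) < e / 2"
    using e by (intro order_tendstoD) auto
  then obtain m where m: "integral {c..d} (\<lambda>t. \<bar>clamp n (g t) - clamp n (k m t)\<bar>) < e / 2"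
    by (auto simp: eventually_sequentially)
  have "integral {c..d} (\<lambda>t. \<bar>g t - clamp n (k m t)\<bar>)
      \<le> integral {c..d} (\<lambda>t. \<bar>g t - clamp n (g t)\<bar> + \<bar>clamp n (g t) - clamp n (k m t)\<bar>)"
    by (intro integral_le integrable_add absint absint2 absolutely_integrable_abs_diff g kint) auto
  also have "\<dots> < e"
    using n m by (subst integral_add[OF absint absint2]) auto
  finally show thesis using that[OF kc] by blast
qed

text \<open>
The \<open>L\<^sup>1\<close> form of the Lebesgue differentiation theorem. It holds for continuous functions by
uniform continuity, and passes to the limit because both \<open>g\<close> and its averages depend on
\<open>g\<close> continuously in \<open>L\<^sup>1\<close>.
\<close>

lemma L1_backward_average:
  fixes g :: "real \<Rightarrow> real"
  assumes g: "g absolutely_integrable_on {c..d}" and ab: "c < a" "a \<le> b" "b \<le> d" and e: "0 < e"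
  shows "\<forall>\<^sub>F h in at_right 0.
     (\<lambda>t. \<bar>integral {t - h..t} g - h * g t\<bar>) integrable_on {a..b} \<and>
     integral {a..b} (\<lambda>t. \<bar>integral {t - h..t} g - h * g t\<bar>) \<le> e * h"
proof -
  \<comment> \<open>The distance of g to the continuous function counts twice, once inside and once outside the
    average; the uniform error for the continuous function is integrated over an interval of length b - a.\<close>
  define e' where "e' = e / (2 + (b - a))"
  have e': "0 < e'" "e' * (2 + (b - a)) = e" using e ab by (auto simp: e'_def)
  obtain k where k: "continuous_on UNIV k" and gk: "integral {c..d} (\<lambda>t. \<bar>g t - k t\<bar>) < e'"
    using absolutely_integrable_approx_continuous[OF g e'(1)] .
  have kI: "k absolutely_integrable_on {c..d}"
    using continuous_on_subset[OF k] by (intro absolutely_integrable_continuous_real) auto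
  have gI: "g integrable_on {c..d}" and kI': "k integrable_on {c..d}"
    using g kI by (auto simp: absolutely_integrable_on_def)
  have dI: "(\<lambda>t. \<bar>g t - k t\<bar>) integrable_on {c..d}"
    by (rule absolutely_integrable_abs_diff[OF g kI])
  obtain \<delta> where \<delta>: "0 < \<delta>" and avg: "\<And>h t. 0 < h \<Longrightarrow> h < \<delta> \<Longrightarrow> c \<le> t - h \<Longrightarrow> t \<le> d \<Longrightarrow>
           \<bar>integral {t - h..t} k - h * k t\<bar> \<le> e' * h"
    using continuous_backward_average[OF continuous_on_subset[OF k subset_UNIV] e'(1), of c d]
    unfolding eventually_at_right_field by blast
  have "(\<lambda>t. \<bar>integral {t - h..t} g - h * g t\<bar>) integrable_on {a..b} \<and>
     integral {a..b} (\<lambda>t. \<bar>integral {t - h..t} g - h * g t\<bar>) \<le> e * h"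
    if h: "0 < h" "h < \<delta>" "h < a - c" for h
  proof
    have "continuous_on {a..b} (\<lambda>t. integral {t - h..t} g)"
      by (rule continuous_on_backward_integral[OF gI]) (use ab h in auto)
    then have "(\<lambda>t. integral {t - h..t} g) absolutely_integrable_on {a..b}"
      by (rule absolutely_integrable_continuous_real)
    moreover have "(\<lambda>t. h * g t) absolutely_integrable_on {a..b}"
      using set_integrable_subset[OF g, of "{a..b}"] ab by auto
    ultimately show I: "(\<lambda>t. \<bar>integral {t - h..t} g - h * g t\<bar>) integrable_on {a..b}"
      by (rule absolutely_integrable_abs_diff)
    have dI': "(\<lambda>t. \<bar>g t - k t\<bar>) integrable_on {a..b}"
      by (rule integrable_subinterval_real[OF dI]) (use ab in auto)
    have hI: "(\<lambda>t. h * \<bar>g t - k t\<bar>) integrable_on {a..b}"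
      using integrable_on_cmult_left[OF dI', of h] by simp
    have bI: "(\<lambda>t. integral {t - h..t} (\<lambda>r. \<bar>g r - k r\<bar>)) integrable_on {a..b}"
      by (rule integrable_continuous_real[OF continuous_on_backward_integral[OF dI]]) (use ab h in auto)
    have "\<bar>integral {t - h..t} g - h * g t\<bar>
        \<le> integral {t - h..t} (\<lambda>r. \<bar>g r - k r\<bar>) + e' * h + h * \<bar>g t - k t\<bar>" if t: "t \<in> {a..b}" for t
    proof -
      have s: "{t - h..t} \<subseteq> {c..d}" using t ab h by auto
      have gt: "g integrable_on {t - h..t}" and kt: "k integrable_on {t - h..t}"
        and dt: "(\<lambda>r. \<bar>g r - k r\<bar>) integrable_on {t - h..t}"
        using integrable_subinterval_real[OF gI s] integrable_subinterval_real[OF kI' s]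
          integrable_subinterval_real[OF dI s] .
      have "integral {t - h..t} g - integral {t - h..t} k = integral {t - h..t} (\<lambda>r. g r - k r)"
        using gt kt by (simp add: integral_diff)
      also have "norm \<dots> \<le> integral {t - h..t} (\<lambda>r. \<bar>g r - k r\<bar>)"
        by (rule integral_norm_bound_integral) (use gt kt dt in \<open>auto intro: integrable_diff\<close>)
      finally have 1: "\<bar>integral {t - h..t} g - integral {t - h..t} k\<bar> \<le> \<dots>" by simp
      have 2: "\<bar>integral {t - h..t} k - h * k t\<bar> \<le> e' * h"
        using avg[OF h(1,2)] t ab h by auto
      have 3: "\<bar>h * k t - h * g t\<bar> = h * \<bar>g t - k t\<bar>"
        using h by (simp add: abs_mult abs_minus_commute flip: right_diff_distrib)
      show ?thesis using 1 2 3 by linarith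
    qed
    then have "integral {a..b} (\<lambda>t. \<bar>integral {t - h..t} g - h * g t\<bar>)
        \<le> integral {a..b} (\<lambda>t. integral {t - h..t} (\<lambda>r. \<bar>g r - k r\<bar>) + e' * h + h * \<bar>g t - k t\<bar>)"
      by (intro integral_le I integrable_add bI hI) auto
    also have "\<dots> = integral {a..b} (\<lambda>t. integral {t - h..t} (\<lambda>r. \<bar>g r - k r\<bar>))
        + (b - a) * (e' * h) + h * integral {a..b} (\<lambda>t. \<bar>g t - k t\<bar>)"
      using ab integral_add[OF integrable_add[OF bI integrable_const_ivl] hI, of "e' * h"]
        integral_add[OF bI integrable_const_ivl, of "e' * h"] by simp
    also have "\<dots> \<le> h * integral {c..d} (\<lambda>t. \<bar>g t - k t\<bar>) + (b - a) * (e' * h)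
        + h * integral {c..d} (\<lambda>t. \<bar>g t - k t\<bar>)"
      by (intro add_mono mult_left_mono backward_integral_le integral_subset_le dI dI' order_refl)
        (use ab h in auto)
    also have "\<dots> \<le> h * e' + (b - a) * (e' * h) + h * e'"
      using gk h by (intro add_mono mult_left_mono order_refl) auto
    also have "\<dots> = e * h" by (subst e'(2)[symmetric]) (simp add: algebra_simps)
    finally show "integral {a..b} (\<lambda>t. \<bar>integral {t - h..t} g - h * g t\<bar>) \<le> e * h" .
  qed
  then show ?thesis
    unfolding eventually_at_right_field using \<delta> ab by (intro exI[of _ "min \<delta> (a - c)"]) auto
qed

section \<open>The energy inequality\<close>

lemma integral_le_AE_lebesgue:
  fixes f g :: "real \<Rightarrow> real"
  assumes f: "f integrable_on {a..b}" and g: "g integrable_on {a..b}"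
    and le: "AE t in lebesgue. t \<in> {a..b} \<longrightarrow> f t \<le> g t"
  shows "integral {a..b} f \<le> integral {a..b} g"
proof -
  obtain N where N: "N \<in> null_sets lebesgue" "{t. \<not> (t \<in> {a..b} \<longrightarrow> f t \<le> g t)} \<subseteq> N"
    using le by (auto simp: eventually_ae_filter)
  then have neg: "negligible N" by (simp add: negligible_iff_null_sets)
  define f' where "f' = (\<lambda>t. if t \<in> N then g t else f t)"
  have "f' integrable_on {a..b}"
    by (rule integrable_spike[OF f neg]) (auto simp: f'_def)
  then have "integral {a..b} f' \<le> integral {a..b} g"
    using N(2) by (intro integral_le g) (auto simp: f'_def)
  also have "integral {a..b} f' = integral {a..b} f"
    by (rule integral_spike[OF neg]) (auto simp: f'_def)
  finally show ?thesis .
qed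

text \<open>
Young's inequality with a small factor. If \<open>y\<close> is at most \<open>\<eta>\<close> times
\<open>x powr (1 / (p - 1))\<close>, the first term alone bounds the product; otherwise \<open>x\<close> is bounded by a
power of \<open>y\<close> and the second term does. The small factor lets an \<open>L\<^sup>q\<close> function that is merely
bounded in norm be tested against an \<open>L\<^sup>p\<close> function of small norm, without Hoelder's inequality.
\<close>

lemma Young_epsilon:
  fixes p \<eta> :: real
  assumes p: "1 < p" and \<eta>: "0 < \<eta>"
  obtains C where "0 \<le> C"
    "\<And>x y. 0 \<le> x \<Longrightarrow> 0 \<le> y \<Longrightarrow> x * y \<le> \<eta> * x powr (p / (p - 1)) + C * y powr p"
proof -
  have "x * y \<le> \<eta> * x powr (p / (p - 1)) + \<eta> powr (1 - p) * y powr p" if "0 \<le> x" "0 \<le> y" for x y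
  proof (cases "x = 0 \<or> y = 0")
    case True
    then show ?thesis using \<eta> p by auto
  next
    case False
    then have pos: "0 < x" "0 < y" using that by auto
    show ?thesis
    proof (cases "y \<le> \<eta> * x powr (1 / (p - 1))")
      case True
      have exponent: "1 + 1 / (p - 1) = p / (p - 1)" using p by (simp add: field_simps)
      have "x * y \<le> x * (\<eta> * x powr (1 / (p - 1)))"
        using True pos by (intro mult_left_mono) auto
      also have "\<dots> = \<eta> * x powr (1 + 1 / (p - 1))"
        using pos by (subst powr_add) simp
      also have "\<dots> = \<eta> * x powr (p / (p - 1))" by (simp only: exponent)
      finally show ?thesis using pos by (auto intro: add_increasing2)
    next
      case False
      then have "x powr (1 / (p - 1)) \<le> y / \<eta>" using \<eta> by (simp add: field_simps)
      then have "(x powr (1 / (p - 1))) powr (p - 1) \<le> (y / \<eta>) powr (p - 1)"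
        using p by (intro powr_mono2) auto
      then have "x \<le> (y / \<eta>) powr (p - 1)"
        using p pos by (simp add: powr_powr)
      then have "x * y \<le> (y / \<eta>) powr (p - 1) * y"
        using pos by (intro mult_right_mono) auto
      also have "\<dots> = \<eta> powr (1 - p) * y powr (p - 1 + 1)"
        using pos \<eta> by (subst powr_add) (simp add: powr_divide powr_diff)
      also have "\<dots> = \<eta> powr (1 - p) * y powr p" by simp
      finally show ?thesis using \<eta> by (auto intro: add_increasing)
    qed
  qed
  then show thesis using that[of "\<eta> powr (1 - p)"] by auto
qed

text \<open>
Simple functions that converge pointwise can be chosen with at most twice the norm of \<open>v\<close>, so the
error is dominated by a multiple of \<open>norm (v t) powr p\<close> and tends to zero in \<open>L\<^sup>p\<close>.
\<close>

lemma Lp_approx_simple: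
  fixes v :: "real \<Rightarrow> 'v::{real_normed_vector,second_countable_topology}"
  assumes v: "set_borel_measurable lebesgue S v" and S: "S \<in> sets lebesgue"
    and vp: "(\<lambda>t. norm (v t) powr p) absolutely_integrable_on S"
    and p: "0 < p" and e: "0 < e"
  obtains \<phi> where "\<phi> \<in> borel_measurable lebesgue" "finite (range \<phi>)"
    "(\<lambda>t. norm (v t - \<phi> t) powr p) absolutely_integrable_on S"
    "integral S (\<lambda>t. norm (v t - \<phi> t) powr p) < e"
proof -
  define V where "V = (\<lambda>t. indicator S t *\<^sub>R v t)"
  have V: "V \<in> borel_measurable lebesgue"
    using v by (simp add: V_def set_borel_measurable_def)
  obtain F where F: "\<And>i. simple_function lebesgue (F i)" "\<And>t. (\<lambda>i. F i t) \<longlonglongrightarrow> V t"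
      "\<And>i t. dist (F i t) 0 \<le> 2 * dist (V t) 0"
    using borel_measurable_implies_sequence_metric[OF V, of 0] by auto
  have Fm: "F i \<in> borel_measurable lebesgue" for i
    using F(1) by (rule borel_measurable_simple_function)
  have bound: "norm (V t - F i t) powr p \<le> 3 powr p * norm (V t) powr p" for i t
  proof -
    have "norm (V t - F i t) \<le> 3 * norm (V t)"
      using norm_triangle_ineq4[of "V t" "F i t"] F(3)[of i t] by (simp add: dist_norm)
    then have "norm (V t - F i t) powr p \<le> (3 * norm (V t)) powr p"
      using p by (intro powr_mono2) auto
    then show ?thesis by (simp add: powr_mult)
  qed
  have dom: "integrable lebesgue (\<lambda>t. 3 powr p * norm (V t) powr p)"
  proof -
    have "indicator S t *\<^sub>R norm (v t) powr p = norm (V t) powr p" for t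
      using p by (simp add: V_def indicator_def)
    then show ?thesis using vp by (auto simp: set_integrable_def)
  qed
  have E: "(\<lambda>t. norm (V t - F i t) powr p) \<in> borel_measurable lebesgue" for i
    using V Fm by measurable
  have I: "integrable lebesgue (\<lambda>t. norm (V t - F i t) powr p)" for i
    by (rule Bochner_Integration.integrable_bound[OF dom E]) (use bound in auto)
  have "(\<lambda>i. integral\<^sup>L lebesgue (\<lambda>t. norm (V t - F i t) powr p)) \<longlonglongrightarrow> integral\<^sup>L lebesgue (\<lambda>t::real. 0)"
  proof (rule integral_dominated_convergence[where w = "\<lambda>t. 3 powr p * norm (V t) powr p"])
    show "AE t in lebesgue. (\<lambda>i. norm (V t - F i t) powr p) \<longlonglongrightarrow> 0"
    proof (rule AE_I2)
      fix t
      have "(\<lambda>i. norm (V t - F i t)) \<longlonglongrightarrow> 0"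
        using tendsto_norm[OF tendsto_diff[OF tendsto_const[of "V t"] F(2)[of t]]] by simp
      then show "(\<lambda>i. norm (V t - F i t) powr p) \<longlonglongrightarrow> 0"
        using tendsto_zero_powrI[of _ sequentially "\<lambda>_. p" p] p by auto
    qed
  qed (use bound dom E in auto)
  then have "\<forall>\<^sub>F i in sequentially. integral\<^sup>L lebesgue (\<lambda>t. norm (V t - F i t) powr p) < e"
    using e by (intro order_tendstoD) auto
  then obtain i where i: "integral\<^sup>L lebesgue (\<lambda>t. norm (V t - F i t) powr p) < e"
    by (auto simp: eventually_sequentially)
  have VS: "indicator S t *\<^sub>R norm (v t - F i t) powr p = indicator S t *\<^sub>R norm (V t - F i t) powr p" for t
    by (simp add: V_def indicator_def)
  have AI: "(\<lambda>t. norm (v t - F i t) powr p) absolutely_integrable_on S"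
    using integrable_mult_indicator[OF S I[of i]] by (simp only: set_integrable_def VS)
  have "integral S (\<lambda>t. norm (v t - F i t) powr p) = (LINT t:S|lebesgue. norm (v t - F i t) powr p)"
    by (rule set_lebesgue_integral_eq_integral(2)[OF AI, symmetric])
  also have "\<dots> = integral\<^sup>L lebesgue (\<lambda>t. indicator S t *\<^sub>R norm (V t - F i t) powr p)"
    unfolding set_lebesgue_integral_def VS ..
  also have "\<dots> \<le> integral\<^sup>L lebesgue (\<lambda>t. norm (V t - F i t) powr p)"
    by (intro integral_mono integrable_mult_indicator S I) (auto simp: indicator_def)
  finally have "integral S (\<lambda>t. norm (v t - F i t) powr p) < e" using i by simp
  moreover have "finite (range (F i))"
    using simple_functionD(1)[OF F(1)[of i]] by simp
  ultimately show thesis using that Fm AI by blast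
qed

lemma bilinear_pairing_absolutely_integrable:
  fixes B :: "'w::{real_normed_vector,second_countable_topology}
      \<Rightarrow> 'v::{real_normed_vector,second_countable_topology} \<Rightarrow> real"
  assumes B: "bounded_bilinear B" and B_le: "\<And>x y. \<bar>B x y\<bar> \<le> norm x * norm y"
    and p: "1 < p"
    and a: "set_borel_measurable lebesgue S a"
    and ap: "(\<lambda>t. norm (a t) powr (p / (p - 1))) absolutely_integrable_on S"
    and v: "set_borel_measurable lebesgue S v"
    and vp: "(\<lambda>t. norm (v t) powr p) absolutely_integrable_on S"
  shows "(\<lambda>t. B (a t) (v t)) absolutely_integrable_on S"
proof -
  obtain C where C: "0 \<le> C"
    "\<And>x y. 0 \<le> x \<Longrightarrow> 0 \<le> y \<Longrightarrow> x * y \<le> 1 * x powr (p / (p - 1)) + C * y powr p"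
    using Young_epsilon[OF p zero_less_one] by blast
  have "(\<lambda>t. B (indicator S t *\<^sub>R a t) (indicator S t *\<^sub>R v t)) \<in> borel_measurable lebesgue"
  proof (rule borel_measurable_continuous_Pair[where H = B])
    show "continuous_on UNIV (\<lambda>x. B (fst x) (snd x))"
      by (intro bounded_bilinear.continuous_on[OF B] continuous_intros)
  qed (use a v in \<open>auto simp: set_borel_measurable_def\<close>)
  moreover have "B (indicator S t *\<^sub>R a t) (indicator S t *\<^sub>R v t) = indicator S t *\<^sub>R B (a t) (v t)" for t
    using bounded_bilinear.scaleR_left[OF B] bounded_bilinear.scaleR_right[OF B]
    by (simp add: indicator_def)
  ultimately have meas: "set_borel_measurable lebesgue S (\<lambda>t. B (a t) (v t))"
    by (simp add: set_borel_measurable_def)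
  have "(\<lambda>t. norm (a t) powr (p / (p - 1)) + C * norm (v t) powr p) absolutely_integrable_on S"
    by (intro set_integral_add(1) ap set_integrable_mult_right vp)
  then show ?thesis
  proof (rule set_integrable_bound[OF _ meas], intro AE_I2 impI)
    show "norm (B (a t) (v t)) \<le> norm (norm (a t) powr (p / (p - 1)) + C * norm (v t) powr p)" for t
      using B_le[of "a t" "v t"] C(2)[of "norm (a t)" "norm (v t)"] C(1) by simp
  qed
qed

text \<open>
If \<open>z\<close> is continuous in the Hilbert space, has a derivative \<open>u\<close> in the dual, and
agrees almost everywhere with a function \<open>v\<close> with values in the smaller space, the chain rule for
\<open>norm (z t) ^ 2\<close> holds, here with \<open>\<le>\<close>. For almost every \<open>t\<close>,

\<open>norm (z t) ^ 2 - norm (z (t - h)) ^ 2 \<le> 2 * inner (z t - z (t - h)) (z t)\<close>,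

since the difference of both sides is a square, and as \<open>z t = j (v t)\<close> the right hand side is twice
the integral of the pairing of \<open>u \<tau>\<close> with \<open>v t\<close> over \<open>\<tau>\<close> in the
backward window. Integrating in \<open>t\<close> and dividing by \<open>h\<close> leaves the convergence of the
averages of the pairing. For a simple function \<open>\<phi>\<close> instead of \<open>v\<close> it follows from
the scalar theorem on averages, applied to each of the finitely many values; the error \<open>v - \<phi>\<close>
is small in \<open>L\<^sup>p\<close> and is absorbed by Young's inequality.

Both end points lie to the right of \<open>c\<close>, which leaves room for the window.
\<close>

theorem energy_inequality:
  fixes B :: "'w::{real_normed_vector,second_countable_topology}
      \<Rightarrow> 'v::{real_normed_vector,second_countable_topology} \<Rightarrow> real"
    and j :: "'v \<Rightarrow> 'h::real_inner" and z :: "real \<Rightarrow> 'h"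
  assumes B: "bounded_bilinear B" and B_le: "\<And>x y. \<bar>B x y\<bar> \<le> norm x * norm y"
    and p: "1 < p"
    and u: "set_borel_measurable lebesgue {c..d} u"
    and up: "(\<lambda>t. norm (u t) powr (p / (p - 1))) absolutely_integrable_on {c..d}"
    and v: "set_borel_measurable lebesgue {c..d} v"
    and vp: "(\<lambda>t. norm (v t) powr p) absolutely_integrable_on {c..d}"
    and z: "continuous_on {c..d} z"
    and zv: "AE t in lebesgue. t \<in> {c..d} \<longrightarrow> z t = j (v t)"
    and dz: "\<And>r t x. c \<le> r \<Longrightarrow> r \<le> t \<Longrightarrow> t \<le> d \<Longrightarrow>
               inner (z t - z r) (j x) = integral {r..t} (\<lambda>\<tau>. B (u \<tau>) x)"
    and ab: "c < a" "a \<le> b" "b \<le> d"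
  shows "(norm (z b))\<^sup>2 - (norm (z a))\<^sup>2 \<le> 2 * integral {a..b} (\<lambda>t. B (u t) (v t))"
proof (rule field_le_epsilon)
  fix \<epsilon> :: real assume \<epsilon>: "0 < \<epsilon>"
  define q where "q = p / (p - 1)"
  define y where "y = (\<lambda>t. (norm (z t))\<^sup>2)"
  define N where "N = integral {c..d} (\<lambda>t. norm (u t) powr q)"
  note uq = up[folded q_def]
  have uI: "(\<lambda>t. norm (u t) powr q) integrable_on {c..d}"
    using uq by (simp add: absolutely_integrable_on_def)
  have N: "0 \<le> N" unfolding N_def by (rule integral_nonneg[OF uI]) simp
  \<comment> \<open>The errors that remain after division by h are 4 N \<eta>, 4 C \<epsilon>', 2 card W \<epsilon>W and \<epsilon>/4; each is at
    most \<epsilon>/4. The order of the choices matters: C depends on \<eta>, then \<phi> on C, then W on \<phi>.\<close>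
  define \<eta> where "\<eta> = \<epsilon> / (16 * (N + 1))"
  have \<eta>: "0 < \<eta>" "\<eta> * N \<le> \<epsilon> / 16"
    using N \<epsilon> by (auto simp: \<eta>_def field_simps)
  obtain C where C: "0 \<le> C"
    and young: "\<And>x y. 0 \<le> x \<Longrightarrow> 0 \<le> y \<Longrightarrow> x * y \<le> \<eta> * x powr q + C * y powr p"
    using Young_epsilon[OF p \<eta>(1)] unfolding q_def by blast
  define \<epsilon>' where "\<epsilon>' = \<epsilon> / (16 * (C + 1))"
  have \<epsilon>': "0 < \<epsilon>'" "C * \<epsilon>' \<le> \<epsilon> / 16"
    using C \<epsilon> by (auto simp: \<epsilon>'_def field_simps)
  obtain \<phi> where \<phi>: "\<phi> \<in> borel_measurable lebesgue" "finite (range \<phi>)"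
    "(\<lambda>t. norm (v t - \<phi> t) powr p) absolutely_integrable_on {c..d}"
    "integral {c..d} (\<lambda>t. norm (v t - \<phi> t) powr p) < \<epsilon>'"
    using Lp_approx_simple[OF v _ vp _ \<epsilon>'(1)] p by auto
  define W where "W = range \<phi>"
  define \<epsilon>W where "\<epsilon>W = \<epsilon> / (8 * (card W + 1))"
  have \<epsilon>W: "0 < \<epsilon>W" "card W * \<epsilon>W \<le> \<epsilon> / 8"
    using \<epsilon> by (auto simp: \<epsilon>W_def field_simps)
  have Bx: "(\<lambda>t. B (u t) x) absolutely_integrable_on {c..d}" for x
  proof (rule bilinear_pairing_absolutely_integrable[OF B B_le p u up])
    show "set_borel_measurable lebesgue {c..d} (\<lambda>t. x)"
      unfolding set_borel_measurable_def
      by (intro borel_measurable_scaleR borel_measurable_indicator borel_measurable_const) simp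
    show "(\<lambda>t. norm x powr p) absolutely_integrable_on {c..d}"
      by (intro absolutely_integrable_continuous_real continuous_intros)
  qed
  have Bv: "(\<lambda>t. B (u t) (v t)) absolutely_integrable_on {c..d}"
    by (rule bilinear_pairing_absolutely_integrable[OF B B_le p u up v vp])
  have BxI: "(\<lambda>t. B (u t) x) integrable_on {r..t}" if "c \<le> r" "t \<le> d" for x r t
    using that by (intro integrable_subinterval_real[OF set_lebesgue_integral_eq_integral(1)[OF Bx]]) auto
  define \<Phi> where "\<Phi> = (\<lambda>h w t. \<bar>integral {t - h..t} (\<lambda>\<tau>. B (u \<tau>) w) - h * B (u t) w\<bar>)"
  have "\<forall>\<^sub>F h in at_right 0. \<forall>w\<in>W. \<Phi> h w integrable_on {a..b} \<and> integral {a..b} (\<Phi> h w) \<le> \<epsilon>W * h"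
    unfolding \<Phi>_def using \<phi>(2)
    by (intro eventually_ball_finite ballI L1_backward_average[OF Bx ab \<epsilon>W(1)]) (simp add: W_def)
  moreover have "continuous_on {c..d} y"
    unfolding y_def by (intro continuous_intros z)
  then have "\<forall>\<^sub>F h in at_right 0. \<forall>t. c \<le> t - h \<and> t \<le> d \<longrightarrow>
        \<bar>integral {t - h..t} y - h * y t\<bar> \<le> \<epsilon> / 8 * h"
    using \<epsilon> by (intro continuous_backward_average) auto
  moreover have "\<forall>\<^sub>F h in at_right 0. 0 < h \<and> h < a - c"
    unfolding eventually_at_right_field using ab by (intro exI[of _ "a - c"]) auto
  ultimately have "\<forall>\<^sub>F h in at_right (0::real).
      (\<forall>w\<in>W. \<Phi> h w integrable_on {a..b} \<and> integral {a..b} (\<Phi> h w) \<le> \<epsilon>W * h) \<and>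
      (\<forall>t. c \<le> t - h \<and> t \<le> d \<longrightarrow> \<bar>integral {t - h..t} y - h * y t\<bar> \<le> \<epsilon> / 8 * h) \<and>
      0 < h \<and> h < a - c"
    by eventually_elim blast
  then obtain h where \<Phi>: "\<And>w. w \<in> W \<Longrightarrow> \<Phi> h w integrable_on {a..b}"
      "\<And>w. w \<in> W \<Longrightarrow> integral {a..b} (\<Phi> h w) \<le> \<epsilon>W * h"
    and y_avg: "\<And>t. c \<le> t - h \<Longrightarrow> t \<le> d \<Longrightarrow> \<bar>integral {t - h..t} y - h * y t\<bar> \<le> \<epsilon> / 8 * h"
    and h: "0 < h" "h < a - c"
    using eventually_happens'[OF trivial_limit_at_right_real] by fast
  define U where "U = (\<lambda>t. norm (u t) powr q)"
  define E where "E = (\<lambda>t. norm (v t - \<phi> t) powr p)"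
  have UI: "U integrable_on {r..t}" if "c \<le> r" "t \<le> d" for r t
    unfolding U_def using that by (intro integrable_subinterval_real[OF uI]) auto
  have EI': "E integrable_on {c..d}"
    unfolding E_def using \<phi>(3) by (rule set_lebesgue_integral_eq_integral(1))
  have EI: "E integrable_on {a..b}"
    using ab by (intro integrable_subinterval_real[OF EI']) auto
  have UE: "\<bar>B (u \<tau>) (v t - \<phi> t)\<bar> \<le> \<eta> * U \<tau> + C * E t" for \<tau> t
    unfolding U_def E_def using B_le young[of "norm (u \<tau>)" "norm (v t - \<phi> t)"]
    by (meson norm_ge_zero order_trans)
  define Q where "Q = (\<lambda>t. h * B (u t) (v t) + \<eta> * integral {t - h..t} U + (\<Sum>w\<in>W. \<Phi> h w t)
      + (h * \<eta>) * U t + (2 * h * C) * E t)"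
  \<comment> \<open>Q bounds the pairing over the window for every t, by integrable scalar functions of t.\<close>
  have pointwise: "integral {t - h..t} (\<lambda>\<tau>. B (u \<tau>) (v t)) \<le> Q t" if t: "t \<in> {a..b}" for t
  proof -
    have st: "c \<le> t - h" "t \<le> d" using t h ab by auto
    have split: "B x (v t) = B x (\<phi> t) + B x (v t - \<phi> t)" for x
      by (simp add: bounded_bilinear.diff_right[OF B])
    have "integral {t - h..t} (\<lambda>\<tau>. B (u \<tau>) (v t))
        = integral {t - h..t} (\<lambda>\<tau>. B (u \<tau>) (\<phi> t)) + integral {t - h..t} (\<lambda>\<tau>. B (u \<tau>) (v t - \<phi> t))"
      unfolding split by (rule integral_add[OF BxI[OF st] BxI[OF st]])
    also have "integral {t - h..t} (\<lambda>\<tau>. B (u \<tau>) (v t - \<phi> t))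
        \<le> integral {t - h..t} (\<lambda>\<tau>. \<eta> * U \<tau> + C * E t)"
      by (intro integral_le BxI[OF st] integrable_add integrable_on_mult_right UI[OF st]
          integrable_const_ivl) (meson UE abs_le_D1)
    also have "\<dots> = \<eta> * integral {t - h..t} U + h * (C * E t)"
      using h by (subst integral_add) (auto intro!: integrable_on_mult_right UI[OF st])
    also have "integral {t - h..t} (\<lambda>\<tau>. B (u \<tau>) (\<phi> t)) \<le> h * B (u t) (\<phi> t) + \<Phi> h (\<phi> t) t"
      unfolding \<Phi>_def by linarith
    also have "\<Phi> h (\<phi> t) t \<le> (\<Sum>w\<in>W. \<Phi> h w t)"
      by (rule member_le_sum) (use \<phi>(2) in \<open>auto simp: W_def \<Phi>_def\<close>)
    also have "h * B (u t) (\<phi> t) \<le> h * B (u t) (v t) + h * (\<eta> * U t + C * E t)"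
    proof -
      have "B (u t) (\<phi> t) \<le> B (u t) (v t) + (\<eta> * U t + C * E t)"
        using UE[of t t] split[of "u t"] by linarith
      then show ?thesis using h by (simp flip: distrib_left)
    qed
    finally show ?thesis by (simp add: Q_def algebra_simps)
  qed
  have QI: "Q integrable_on {a..b}"
    and Q_int: "integral {a..b} Q = h * integral {a..b} (\<lambda>t. B (u t) (v t))
      + \<eta> * integral {a..b} (\<lambda>t. integral {t - h..t} U) + (\<Sum>w\<in>W. integral {a..b} (\<Phi> h w))
      + (h * \<eta>) * integral {a..b} U + (2 * h * C) * integral {a..b} E"
  proof -
    have BvI: "(\<lambda>t. B (u t) (v t)) integrable_on {a..b}"
      by (rule integrable_subinterval_real[OF set_lebesgue_integral_eq_integral(1)[OF Bv]])
        (use ab in auto)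
    have bU: "(\<lambda>t. integral {t - h..t} U) integrable_on {a..b}"
      by (rule integrable_continuous_real[OF continuous_on_backward_integral[OF UI[OF order_refl order_refl]]])
        (use ab h in auto)
    have W: "finite W" using \<phi>(2) by (simp add: W_def)
    have "(Q has_integral (h * integral {a..b} (\<lambda>t. B (u t) (v t))
      + \<eta> * integral {a..b} (\<lambda>t. integral {t - h..t} U) + (\<Sum>w\<in>W. integral {a..b} (\<Phi> h w))
      + (h * \<eta>) * integral {a..b} U + (2 * h * C) * integral {a..b} E)) {a..b}"
      unfolding Q_def
      by (intro has_integral_add has_integral_mult_right has_integral_sum W integrable_integral
          BvI bU \<Phi>(1) UI EI) (use ab in auto)
    then show "Q integrable_on {a..b}" "integral {a..b} Q = h * integral {a..b} (\<lambda>t. B (u t) (v t))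
      + \<eta> * integral {a..b} (\<lambda>t. integral {t - h..t} U) + (\<Sum>w\<in>W. integral {a..b} (\<Phi> h w))
      + (h * \<eta>) * integral {a..b} U + (2 * h * C) * integral {a..b} E"
      by (auto simp: integrable_on_def integral_unique)
  qed
  have "continuous_on {a - h..b} y"
    unfolding y_def by (intro continuous_intros continuous_on_subset[OF z]) (use ab h in auto)
  note diff = integral_backward_difference[OF this less_imp_le[OF h(1)] ab(2)]
  have "integral {a..b} (\<lambda>t. y t - y (t - h)) \<le> integral {a..b} (\<lambda>t. 2 * Q t)"
  proof (rule integral_le_AE_lebesgue[OF diff(1)])
    show "AE t in lebesgue. t \<in> {a..b} \<longrightarrow> y t - y (t - h) \<le> 2 * Q t"
      using zv
    proof eventually_elim
      case (elim t)
      show ?case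
      proof
        assume t: "t \<in> {a..b}"
        have "0 \<le> (norm (z t - z (t - h)))\<^sup>2" by simp
        then have "y t - y (t - h) \<le> 2 * inner (z t - z (t - h)) (z t)"
          unfolding y_def power2_norm_eq_inner
          by (simp add: inner_diff_left inner_diff_right inner_commute)
        also have "inner (z t - z (t - h)) (z t) = integral {t - h..t} (\<lambda>\<tau>. B (u \<tau>) (v t))"
          using elim dz[of "t - h" t "v t"] t h ab by auto
        also have "\<dots> \<le> Q t" by (rule pointwise[OF t])
        finally show "y t - y (t - h) \<le> 2 * Q t" by simp
      qed
    qed
  qed (intro integrable_on_mult_right QI)
  then have "integral {b - h..b} y - integral {a - h..a} y \<le> 2 * integral {a..b} Q"
    by (simp add: diff(2))
  moreover have "\<bar>integral {b - h..b} y - h * y b\<bar> \<le> \<epsilon> / 8 * h" "\<bar>integral {a - h..a} y - h * y a\<bar> \<le> \<epsilon> / 8 * h"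
    by (rule y_avg; use ab h in simp)+
  moreover have "integral {a..b} Q \<le> h * integral {a..b} (\<lambda>t. B (u t) (v t)) + h * (3 * \<epsilon> / 8)"
  proof -
    have nn: "0 \<le> U t" "0 \<le> E t" for t by (auto simp: U_def E_def)
    have "integral {a..b} (\<lambda>t. integral {t - h..t} U) \<le> h * N"
      unfolding N_def U_def[symmetric]
      by (rule backward_integral_le[OF UI[OF order_refl order_refl]]) (use nn ab h in auto)
    then have 1: "\<eta> * integral {a..b} (\<lambda>t. integral {t - h..t} U) \<le> h * (\<eta> * N)"
      using mult_left_mono[of _ _ \<eta>] \<eta>(1) by (metis less_imp_le mult.left_commute)
    have "integral {a..b} U \<le> N"
      unfolding N_def U_def[symmetric] by (rule integral_subset_le) (use nn ab in \<open>auto intro!: UI\<close>)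
    then have 2: "(h * \<eta>) * integral {a..b} U \<le> h * (\<eta> * N)"
      using mult_left_mono[of _ _ "h * \<eta>"] \<eta>(1) h by (simp add: mult.assoc)
    have "integral {a..b} E \<le> integral {c..d} E"
      by (rule integral_subset_le) (use nn ab EI EI' in auto)
    then have "integral {a..b} E \<le> \<epsilon>'" using \<phi>(4) by (simp add: E_def)
    then have 3: "(2 * h * C) * integral {a..b} E \<le> 2 * (h * (C * \<epsilon>'))"
      using mult_left_mono[of _ _ "2 * h * C"] C h by (simp add: mult.assoc)
    have "(\<Sum>w\<in>W. integral {a..b} (\<Phi> h w)) \<le> (\<Sum>w\<in>W. \<epsilon>W * h)"
      by (rule sum_mono[OF \<Phi>(2)])
    then have 4: "(\<Sum>w\<in>W. integral {a..b} (\<Phi> h w)) \<le> h * (card W * \<epsilon>W)"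
      by (simp add: mult_ac)
    have "h * (\<eta> * N) \<le> h * (\<epsilon> / 16)" "h * (C * \<epsilon>') \<le> h * (\<epsilon> / 16)" "h * (card W * \<epsilon>W) \<le> h * (\<epsilon> / 8)"
      using \<eta>(2) \<epsilon>'(2) \<epsilon>W(2) h by (auto intro: mult_left_mono)
    then show ?thesis unfolding Q_int using 1 2 3 4 by (simp add: algebra_simps)
  qed
  ultimately have "h * (y b - y a) \<le> h * (2 * integral {a..b} (\<lambda>t. B (u t) (v t)) + \<epsilon>)"
    unfolding abs_le_iff by (simp add: algebra_simps)
  then show "(norm (z b))\<^sup>2 - (norm (z a))\<^sup>2 \<le> 2 * integral {a..b} (\<lambda>t. B (u t) (v t)) + \<epsilon>"
    using h by (simp add: y_def)
qed

section \<open>Extinction in finite time\<close>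

text \<open>
Continuous induction: the set where \<open>F\<close> does not exceed \<open>F a\<close> is closed, so it contains
its supremum, from which the local hypothesis would carry it further. The step length may depend on
\<open>t\<close> without any lower bound.
\<close>

lemma decreasing_if_locally_right_decreasing:
  fixes F :: "real \<Rightarrow> real"
  assumes F: "continuous_on {a..b} F" and ab: "a \<le> b"
    and loc: "\<And>t. a \<le> t \<Longrightarrow> t < b \<Longrightarrow> \<exists>\<delta>>0. \<forall>r. t \<le> r \<and> r \<le> t + \<delta> \<and> r \<le> b \<longrightarrow> F r \<le> F t"
  shows "F b \<le> F a"
proof (rule ccontr)
  assume neg: "\<not> F b \<le> F a"
  define S where "S = {x \<in> {a..b}. F x \<le> F a}"
  have "closed S"
    unfolding S_def by (intro continuous_on_closed_Collect_le F continuous_on_const) simp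
  moreover have ne: "S \<noteq> {}" "bdd_above S" using ab by (auto simp: S_def)
  ultimately have "Sup S \<in> S" by (intro closed_contains_Sup)
  then have c: "a \<le> Sup S" "Sup S \<le> b" "F (Sup S) \<le> F a" by (auto simp: S_def)
  with neg have "Sup S < b" by (cases "Sup S = b") auto
  then obtain \<delta> where \<delta>: "0 < \<delta>"
    "\<And>r. Sup S \<le> r \<Longrightarrow> r \<le> Sup S + \<delta> \<Longrightarrow> r \<le> b \<Longrightarrow> F r \<le> F (Sup S)"
    using loc[OF c(1)] by blast
  define r where "r = min b (Sup S + \<delta>)"
  have "r \<in> S" using \<delta>(2)[of r] \<delta>(1) c \<open>Sup S < b\<close> by (auto simp: S_def r_def)
  then have "r \<le> Sup S" by (rule cSup_upper[OF _ ne(2)])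
  then show False using \<delta>(1) \<open>Sup S < b\<close> by (simp add: r_def)
qed

text \<open>
The integral form of \<open>y' \<le> - m * y powr (p / 2)\<close> with sublinear exponent \<open>p / 2 < 1\<close>.
Formally \<open>y powr (1 - p / 2)\<close> decreases at least with speed \<open>(1 - p / 2) * m\<close>, so it must
reach zero. As \<open>y\<close> need not be differentiable, the argument is run on
\<open>W r = y t + integral {r..t} (m * y powr (p / 2))\<close>, for the fixed final time \<open>t\<close>: it is
differentiable, it lies below \<open>y\<close>, agrees with \<open>y\<close> at \<open>t\<close>, and its
derivative \<open>- m * y powr (p / 2)\<close> is at most \<open>- m * W powr (p / 2)\<close>. Integrating
backwards from \<open>t\<close> is what makes this last comparison go in the required direction.
\<close>

lemma finite_time_extinction:
  fixes y m :: "real \<Rightarrow> real"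
  assumes y: "continuous_on {s..t} y" and y0: "\<And>r. r \<in> {s..t} \<Longrightarrow> 0 \<le> y r"
    and m: "continuous_on {s..t} m" and m0: "\<And>r. r \<in> {s..t} \<Longrightarrow> 0 \<le> m r"
    and st: "s \<le> t" and p: "0 < p" "p < 2"
    and decay: "\<And>a b. s \<le> a \<Longrightarrow> a \<le> b \<Longrightarrow> b \<le> t \<Longrightarrow>
           y b - y a \<le> - integral {a..b} (\<lambda>r. m r * y r powr (p / 2))"
    and long: "y s powr (1 - p / 2) \<le> (1 - p / 2) * integral {s..t} m"
  shows "y t = 0"
proof (rule ccontr)
  assume "y t \<noteq> 0"
  then have yt: "0 < y t" using y0[of t] st by force
  define k where "k = 1 - p / 2"
  have k: "0 < k" using p by (simp add: k_def)
  define g where "g = (\<lambda>r. m r * y r powr (p / 2))"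
  have g: "continuous_on {s..t} g"
    unfolding g_def using p y0 by (intro continuous_intros m y continuous_on_powr') auto
  have g0: "0 \<le> g r" if "r \<in> {s..t}" for r using m0[OF that] by (simp add: g_def)
  have gI: "g integrable_on {r..t}" if "s \<le> r" for r
    using that by (intro integrable_continuous_real continuous_on_subset[OF g]) auto
  define W where "W = (\<lambda>r. y t + integral {r..t} g)"
  have W_pos: "0 < W r" if "r \<in> {s..t}" for r
    unfolding W_def using that yt g0 by (intro add_pos_nonneg integral_nonneg gI) auto
  have W_le: "W r \<le> y r" if "r \<in> {s..t}" for r
    using decay[of r t] that by (simp add: W_def g_def)
  define V where "V = (\<lambda>r. W r powr k - k * integral {r..t} m)"
  have V': "(V has_real_derivative (k * W r powr (k - 1) * (- g r) - k * (- m r))) (at r within {s..t})"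
    if r: "r \<in> {s..t}" for r
  proof -
    have "(W has_real_derivative - g r) (at r within {s..t})"
      unfolding W_def using integral_has_real_derivative'[OF g r] by (auto intro!: derivative_eq_intros)
    from DERIV_chain'[OF this has_real_derivative_powr[OF W_pos[OF r], of k]]
    have "((\<lambda>r. W r powr k) has_real_derivative (k * W r powr (k - 1) * (- g r))) (at r within {s..t})" .
    moreover have "((\<lambda>r. integral {r..t} m) has_real_derivative - m r) (at r within {s..t})"
      by (rule integral_has_real_derivative'[OF m r])
    ultimately show ?thesis unfolding V_def by (intro DERIV_diff DERIV_cmult)
  qed
  have V'_le: "k * W r powr (k - 1) * (- g r) - k * (- m r) \<le> 0" if r: "r \<in> {s..t}" for r
  proof -
    have "m r = m r * (W r powr (k - 1) * W r powr (p / 2))"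
      using W_pos[OF r] by (simp add: k_def flip: powr_add)
    also have "\<dots> \<le> m r * (W r powr (k - 1) * y r powr (p / 2))"
      using W_pos[OF r] W_le[OF r] m0[OF r] p by (intro mult_left_mono powr_mono2) auto
    finally have "m r \<le> W r powr (k - 1) * g r" by (simp add: g_def mult_ac)
    from mult_left_mono[OF this, of k] show ?thesis using k by (simp add: mult.assoc)
  qed
  have "V t \<le> V s"
  proof (rule DERIV_nonpos_imp_decreasing_open[OF st])
    show "\<exists>D. (V has_real_derivative D) (at r) \<and> D \<le> 0" if "s < r" "r < t" for r
      using V'[of r] V'_le[of r] that by (auto simp: at_within_Icc_at)
    show "continuous_on {s..t} V"
      using V' by (meson DERIV_isCont has_field_derivative_imp_has_derivative
          has_derivative_continuous continuous_on_eq_continuous_within)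
  qed
  moreover have "W s powr k \<le> y s powr k"
    using W_pos[of s] W_le[of s] st k by (intro powr_mono2) auto
  moreover have "V t = y t powr k" "V s = W s powr k - k * integral {s..t} m"
    by (simp_all add: V_def W_def)
  moreover have "y s powr k \<le> k * integral {s..t} m" using long by (simp add: k_def)
  ultimately have "y t powr k \<le> 0" by linarith
  then show False using yt by simp
qed

section \<open>Divergence of the exponential functional of Brownian motion\<close>

lemma wiener_prob_space: "two_sided_wiener_space P \<Longrightarrow> prob_space P"
  by (simp add: two_sided_wiener_space_def)

lemma wiener_space: "two_sided_wiener_space P \<Longrightarrow> space P = wiener_paths"
  by (simp add: two_sided_wiener_space_def)

lemma wiener_evaluation_measurable:
  assumes "two_sided_wiener_space P"
  shows "(\<lambda>\<omega>. \<omega> t) \<in> borel_measurable P"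
proof -
  have "sets P = sets (restrict_space (PiM UNIV (\<lambda>_. borel)) wiener_paths)"
    using assms by (simp add: two_sided_wiener_space_def)
  then have "borel_measurable P
      = (borel_measurable (restrict_space (PiM UNIV (\<lambda>_. borel)) wiener_paths) :: (path \<Rightarrow> real) set)"
    by (rule measurable_cong_sets) simp
  moreover have "(\<lambda>\<omega>::path. \<omega> t) \<in> borel_measurable (restrict_space (PiM UNIV (\<lambda>_. borel)) wiener_paths)"
    by (intro measurable_restrict_space1 measurable_component_singleton) simp
  ultimately show ?thesis by simp
qed

text \<open>
Paths are continuous, hence pointwise limits of their values at the grid points below \<open>t\<close>; for a
fixed grid only countably many evaluations occur.
\<close>

lemma wiener_jointly_measurable:
  assumes P: "two_sided_wiener_space P"
  shows "(\<lambda>(t, \<omega>). \<omega> t) \<in> borel_measurable (borel \<Otimes>\<^sub>M P)"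
proof (rule borel_measurable_LIMSEQ_real)
  define r where "r = (\<lambda>n (t::real). real_of_int \<lfloor>real (Suc n) * t\<rfloor> / real (Suc n))"
  show "(\<lambda>(t, \<omega>). \<omega> (r n t)) \<in> borel_measurable (borel \<Otimes>\<^sub>M P)" for n
  proof -
    have "(\<lambda>x. (\<lambda>i x. snd x (real_of_int i / real (Suc n))) \<lfloor>real (Suc n) * fst x\<rfloor> x)
        \<in> borel_measurable (borel \<Otimes>\<^sub>M P)"
    proof (rule measurable_compose_countable'[where I = UNIV
          and f = "\<lambda>i x. snd x (real_of_int i / real (Suc n))"])
      show "(\<lambda>x. snd x (real_of_int i / real (Suc n))) \<in> borel_measurable (borel \<Otimes>\<^sub>M P)" for i
        by (rule measurable_compose[OF measurable_snd wiener_evaluation_measurable[OF P]])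
      show "(\<lambda>x. \<lfloor>real (Suc n) * fst x\<rfloor>) \<in> borel \<Otimes>\<^sub>M P \<rightarrow>\<^sub>M count_space UNIV"
        by measurable
    qed simp
    then show ?thesis by (simp add: r_def case_prod_unfold)
  qed
  fix x :: "real \<times> path" assume "x \<in> space (borel \<Otimes>\<^sub>M P)"
  then have "snd x \<in> space P" by (simp add: space_pair_measure mem_Times_iff)
  then have cont: "continuous_on UNIV (snd x)"
    unfolding wiener_space[OF P] by (simp add: wiener_paths_def)
  have "(\<lambda>n. r n t) \<longlonglongrightarrow> t" for t
  proof (rule tendsto_sandwich)
    show "\<forall>\<^sub>F n in sequentially. t - inverse (real (Suc n)) \<le> r n t"
    proof (intro always_eventually allI)
      fix n
      have "(t - inverse (real (Suc n))) * real (Suc n) = real (Suc n) * t - 1"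
        by (simp add: field_simps del: of_nat_Suc)
      also have "\<dots> \<le> real_of_int \<lfloor>real (Suc n) * t\<rfloor>" by linarith
      finally show "t - inverse (real (Suc n)) \<le> r n t"
        unfolding r_def by (subst pos_le_divide_eq) simp_all
    qed
    show "\<forall>\<^sub>F n in sequentially. r n t \<le> t"
      unfolding r_def by (intro always_eventually allI, subst pos_divide_le_eq) (simp_all add: mult.commute)
    show "(\<lambda>n. t - inverse (real (Suc n))) \<longlonglongrightarrow> t"
      using tendsto_diff[OF tendsto_const[of t] LIMSEQ_inverse_real_of_nat] by simp
  qed simp
  then have "(\<lambda>n. snd x (r n (fst x))) \<longlonglongrightarrow> snd x (fst x)"
    using cont by (intro continuous_on_tendsto_compose[of UNIV "snd x"]) auto
  then show "(\<lambda>n. case x of (t, \<omega>) \<Rightarrow> \<omega> (r n t)) \<longlonglongrightarrow> (case x of (t, \<omega>) \<Rightarrow> \<omega> t)"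
    by (simp add: case_prod_unfold)
qed

lemma std_normal_tail_pos: "0 < (\<integral>\<^sup>+x. ennreal (std_normal_density x) * indicator {1..} x \<partial>lborel)"
proof (rule ccontr)
  assume "\<not> ?thesis"
  then have "(\<integral>\<^sup>+x. ennreal (std_normal_density x) * indicator {1..} x \<partial>lborel) = 0" by simp
  then have "AE x in lborel. ennreal (std_normal_density x) * indicator {1..} x = 0"
    by (subst (asm) nn_integral_0_iff_AE) auto
  then have "AE x in lborel. x \<notin> {1..2::real}"
  proof eventually_elim
    case (elim x)
    then show ?case
      using normal_density_pos[of 1 0 x] by (auto simp: indicator_def split: if_splits)
  qed
  then have "{1..2::real} \<in> null_sets lborel"
    by (simp add: AE_iff_null_sets)
  then show False by (simp add: null_sets_def)
qed

text \<open>
The form of the second Borel-Cantelli lemma for probabilities bounded away from zero. By the zero-one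
law the only alternative is that almost surely finitely many events occur, but then their indicators
tend to zero almost surely, and so do the probabilities.
\<close>

lemma (in prob_space) infinitely_many_of_indep_events:
  fixes Q :: "nat \<Rightarrow> 'a \<Rightarrow> bool"
  assumes indep: "indep_events (\<lambda>n. {x \<in> space M. Q n x}) UNIV"
    and q: "0 < q" "\<And>n. q \<le> prob {x \<in> space M. Q n x}"
  shows "AE x in M. infinite {n. Q n x}"
proof -
  have ev [measurable]: "{x \<in> space M. Q n x} \<in> events" for n
    using indep by (auto simp: indep_events_def)
  consider "AE x in M. infinite {n. Q n x}" | "AE x in M. finite {n. Q n x}"
    using borel_0_1_law_AE[OF indep] by auto
  then show ?thesis
  proof cases
    case 2
    have "(\<lambda>n. \<integral>x. indicat_real {x \<in> space M. Q n x} x \<partial>M) \<longlonglongrightarrow> (\<integral>x. 0 \<partial>M)"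
    proof (rule integral_dominated_convergence[where w = "\<lambda>_. 1"])
      show "AE x in M. (\<lambda>n. indicat_real {x \<in> space M. Q n x} x) \<longlonglongrightarrow> 0"
        using 2
      proof eventually_elim
        case (elim x)
        then obtain N where "\<And>n. Q n x \<Longrightarrow> n < N"
          using finite_nat_set_iff_bounded by auto
        then have "\<not> Q n x" if "N \<le> n" for n using that leD by blast
        then have "\<forall>\<^sub>F n in sequentially. indicat_real {x \<in> space M. Q n x} x = 0"
          unfolding eventually_sequentially by (intro exI[of _ N]) (auto simp: indicator_def)
        then show ?case by (rule tendsto_eventually)
      qed
    qed (auto simp: indicator_def)
    moreover have "{x \<in> space M. Q n x} \<inter> space M = {x \<in> space M. Q n x}" for n by auto
    ultimately have "(\<lambda>n. prob {x \<in> space M. Q n x}) \<longlonglongrightarrow> 0" by simp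
    then have "q \<le> 0" by (rule LIMSEQ_le_const) (use q(2) in auto)
    with q(1) show ?thesis by simp
  qed
qed

text \<open>
Along times that grow fast enough, the increment over \<open>[\<tau> k, \<tau> (Suc k)]\<close> decides the
sign of the path at \<open>\<tau> (Suc k)\<close>. Let \<open>\<sigma> k\<close> be its standard deviation. The
normalised increments are independent standard normal variables, so infinitely often the increment is at
least \<open>\<sigma> k\<close> in the direction of \<open>c\<close>. By Chebyshev's inequality the probability that
\<open>\<bar>\<omega> (\<tau> k)\<bar>\<close> reaches \<open>\<sigma> k\<close> is at most the \<open>k\<close>-th term
of the series that is assumed to converge, so this happens only finitely often.
\<close>

lemma wiener_nonneg_infinitely_often:
  assumes P: "two_sided_wiener_space P" and c: "c \<noteq> 0"
    and \<tau>: "strict_mono \<tau>" "0 < \<tau> (0::nat)"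
    and sparse: "summable (\<lambda>k. \<tau> k / (\<tau> (Suc k) - \<tau> k))"
  shows "AE \<omega> in P. \<forall>n. \<exists>k\<ge>n. 0 \<le> c * \<omega> (\<tau> k)"
proof -
  interpret prob_space P by (rule wiener_prob_space[OF P])
  have [measurable]: "(\<lambda>\<omega>. \<omega> t) \<in> borel_measurable P" for t
    by (rule wiener_evaluation_measurable[OF P])
  have normal: "distributed P lborel (\<lambda>\<omega>. \<omega> t - \<omega> s) (normal_density 0 (sqrt (t - s)))" if "s < t" for s t
    using P that by (simp add: two_sided_wiener_space_def)
  have \<tau>_pos: "0 < \<tau> k" for k
    using \<tau> strict_mono_leD[OF \<tau>(1), of 0 k] by simp
  have step: "\<tau> k < \<tau> (Suc k)" for k using \<tau>(1) by (simp add: strict_mono_Suc_iff)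
  define \<sigma> where "\<sigma> = (\<lambda>k. sqrt (\<tau> (Suc k) - \<tau> k))"
  have \<sigma>: "0 < \<sigma> k" "(\<sigma> k)\<^sup>2 = \<tau> (Suc k) - \<tau> k" for k using step[of k] by (auto simp: \<sigma>_def)
  define Q where "Q = (\<lambda>k x. 1 \<le> sgn c / \<sigma> k * x)"
  have prob_Q: "emeasure P {\<omega> \<in> space P. Q k (\<omega> (\<tau> (Suc k)) - \<omega> (\<tau> k))}
      = (\<integral>\<^sup>+x. ennreal (std_normal_density x) * indicator {1..} x \<partial>lborel)" for k
  proof -
    have "distributed P lborel (\<lambda>\<omega>. 0 + (sgn c / \<sigma> k) * (\<omega> (\<tau> (Suc k)) - \<omega> (\<tau> k)))
        (normal_density (0 + (sgn c / \<sigma> k) * 0) (\<bar>sgn c / \<sigma> k\<bar> * \<sigma> k))"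
      using normal[OF step[of k]] \<sigma>(1)[of k] c
      by (intro normal_density_affine) (auto simp: \<sigma>_def sgn_zero_iff)
    moreover have "\<bar>sgn c / \<sigma> k\<bar> * \<sigma> k = 1" using \<sigma>(1)[of k] c by (simp add: abs_sgn_eq)
    ultimately have "distributed P lborel (\<lambda>\<omega>. (sgn c / \<sigma> k) * (\<omega> (\<tau> (Suc k)) - \<omega> (\<tau> k))) std_normal_density"
      by (simp only: add_0_left mult_zero_right)
    from distributed_emeasure[OF this, of "{1..}"] show ?thesis
      by (simp add: Q_def vimage_def Int_def conj_commute)
  qed
  define q where "q = enn2real (\<integral>\<^sup>+x. ennreal (std_normal_density x) * indicator {1..} x \<partial>lborel)"
  have prob_Q': "prob {\<omega> \<in> space P. Q k (\<omega> (\<tau> (Suc k)) - \<omega> (\<tau> k))} = q" for k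
    unfolding measure_def prob_Q q_def ..
  have "emeasure P {\<omega> \<in> space P. Q 0 (\<omega> (\<tau> (Suc 0)) - \<omega> (\<tau> 0))} \<noteq> top" by simp
  then have q: "0 < q"
    unfolding q_def prob_Q using std_normal_tail_pos by (simp add: enn2real_positive_iff top.not_eq_extremum)
  have "indep_vars (\<lambda>_. borel) (\<lambda>k \<omega>. \<omega> (\<tau> (Suc k)) - \<omega> (\<tau> k)) UNIV"
  proof -
    have fin: "indep_vars (\<lambda>_. borel) (\<lambda>k \<omega>. \<omega> (\<tau> (Suc k)) - \<omega> (\<tau> k)) {..<n}" for n
      using P \<tau>(1) by (simp add: two_sided_wiener_space_def)
    show ?thesis
      unfolding indep_vars_def2
    proof (intro conjI ballI)
      show "indep_sets (\<lambda>k. {(\<lambda>\<omega>. \<omega> (\<tau> (Suc k)) - \<omega> (\<tau> k)) -` A \<inter> space P |A. A \<in> sets borel}) UNIV"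
      proof (subst indep_sets_finite_index_sets, intro allI impI)
        fix J :: "nat set" assume "finite J"
        then obtain n where n: "J \<subseteq> {..<n}" using finite_nat_iff_bounded by auto
        show "indep_sets (\<lambda>k. {(\<lambda>\<omega>. \<omega> (\<tau> (Suc k)) - \<omega> (\<tau> k)) -` A \<inter> space P |A. A \<in> sets borel}) J"
          using fin[of n] by (intro indep_sets_mono_index[OF n]) (auto simp: indep_vars_def2)
      qed
    qed simp
  qed
  then have "indep_events (\<lambda>k. {\<omega> \<in> space P. Q k (\<omega> (\<tau> (Suc k)) - \<omega> (\<tau> k))}) UNIV"
    by (rule indep_eventsI_indep_vars) (simp add: Q_def)
  then have often: "AE \<omega> in P. infinite {k. Q k (\<omega> (\<tau> (Suc k)) - \<omega> (\<tau> k))}"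
    by (rule infinitely_many_of_indep_events[OF _ q]) (simp add: prob_Q')
  have "prob {\<omega> \<in> space P. \<sigma> k \<le> \<bar>\<omega> (\<tau> k)\<bar>} \<le> \<tau> k / (\<tau> (Suc k) - \<tau> k)" for k
  proof -
    have D: "distributed P lborel (\<lambda>\<omega>. \<omega> (\<tau> k) - \<omega> 0) (normal_density 0 (sqrt (\<tau> k)))"
      using normal[OF \<tau>_pos[of k]] by simp
    have s: "0 < sqrt (\<tau> k)" using \<tau>_pos[of k] by simp
    have "integrable P (\<lambda>\<omega>. (\<omega> (\<tau> k) - \<omega> 0)\<^sup>2)"
      using distributed_integrable[OF D, of "\<lambda>x. x\<^sup>2"] integrable_normal_moment[OF s, of 0 2] by simp
    from Chebyshev_inequality[OF _ this \<sigma>(1)[of k]]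
    have "prob {\<omega> \<in> space P. \<sigma> k \<le> \<bar>\<omega> (\<tau> k) - \<omega> 0\<bar>} \<le> \<tau> k / (\<tau> (Suc k) - \<tau> k)"
      using normal_distributed_expectation[OF s D] normal_distributed_variance[OF s D] \<tau>_pos[of k]
      by (simp add: \<sigma>(2))
    also have "{\<omega> \<in> space P. \<sigma> k \<le> \<bar>\<omega> (\<tau> k) - \<omega> 0\<bar>} = {\<omega> \<in> space P. \<sigma> k \<le> \<bar>\<omega> (\<tau> k)\<bar>}"
      unfolding wiener_space[OF P] by (auto simp: wiener_paths_def)
    finally show ?thesis .
  qed
  then have "summable (\<lambda>k. prob {\<omega> \<in> space P. \<sigma> k \<le> \<bar>\<omega> (\<tau> k)\<bar>})"
    by (intro summable_comparison_test'[OF sparse, of 0]) auto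
  then have "AE \<omega> in P. \<forall>\<^sub>F k in sequentially. \<omega> \<in> space P - {\<omega> \<in> space P. \<sigma> k \<le> \<bar>\<omega> (\<tau> k)\<bar>}"
    by (intro borel_cantelli_AE1) (auto simp: less_top[symmetric])
  with often show ?thesis
  proof eventually_elim
    case (elim \<omega>)
    obtain N where "\<forall>k\<ge>N. \<omega> \<in> space P - {\<omega> \<in> space P. \<sigma> k \<le> \<bar>\<omega> (\<tau> k)\<bar>}"
      using elim(2) unfolding eventually_sequentially by blast
    then have N: "\<bar>\<omega> (\<tau> k)\<bar> < \<sigma> k" if "N \<le> k" for k
      using that by force
    show ?case
    proof
      fix n
      obtain k where k: "max n N \<le> k" "Q k (\<omega> (\<tau> (Suc k)) - \<omega> (\<tau> k))"
        using elim(1) unfolding infinite_nat_iff_unbounded_le by blast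
      have "\<sigma> k \<le> sgn c * (\<omega> (\<tau> (Suc k)) - \<omega> (\<tau> k))"
        using k(2) \<sigma>(1)[of k] by (simp add: Q_def field_simps)
      moreover have "\<bar>sgn c * \<omega> (\<tau> k)\<bar> < \<sigma> k"
        using N[of k] k(1) c by (simp add: abs_mult abs_sgn_eq)
      ultimately have "0 \<le> sgn c * \<omega> (\<tau> (Suc k))" by (simp add: right_diff_distrib)
      then have "0 \<le> \<bar>c\<bar> * (sgn c * \<omega> (\<tau> (Suc k)))" by simp
      then have "0 \<le> c * \<omega> (\<tau> (Suc k))" by (simp add: abs_mult_sgn flip: mult.assoc)
      then show "\<exists>k\<ge>n. 0 \<le> c * \<omega> (\<tau> k)" using k(1) by (intro exI[of _ "Suc k"]) auto
    qed
  qed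
qed

text \<open>
The converse use of the first Borel-Cantelli lemma, on the unit interval with Lebesgue measure. Let
\<open>A k\<close> be the set of \<open>u\<close> with \<open>1 \<le> g (\<tau> (k0 + k) + u)\<close>. Its measure
is at most the integral of \<open>g\<close> over the unit interval that starts at \<open>\<tau> (k0 + k)\<close>,
and these intervals do not overlap. If the integrals of \<open>g\<close> were bounded, the measures would be
summable, and almost every \<open>u\<close> would lie in only finitely many \<open>A k\<close>.
\<close>

lemma integral_unbounded_if_often_large:
  fixes g :: "real \<Rightarrow> real"
  assumes g: "continuous_on UNIV g" and g0: "\<And>r. 0 \<le> g r"
    and \<tau>: "\<And>k. \<tau> k + 1 \<le> \<tau> (Suc k)"
    and often: "AE u in lebesgue. u \<in> {0..1} \<longrightarrow> (\<forall>n. \<exists>k\<ge>n. 1 \<le> g (\<tau> k + u))"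
  shows "\<exists>t\<ge>s. M \<le> integral {s..t} g"
proof (rule ccontr)
  assume "\<not> ?thesis"
  then have bound: "integral {s..t} g \<le> M" if "s \<le> t" for t using that by force
  have gI: "g integrable_on {a..b}" for a b
    by (intro integrable_continuous_real continuous_on_subset[OF g]) auto
  have grow: "\<tau> 0 + real k \<le> \<tau> k" for k
    using \<tau> by (induction k) (auto intro: order_trans[OF _ \<tau>])
  obtain k0 where "s - \<tau> 0 \<le> real k0" using real_arch_simple by blast
  then have k0: "s \<le> \<tau> (k0 + k)" for k using grow[of "k0 + k"] by simp
  define A where "A = (\<lambda>k. {u \<in> {0..1}. 1 \<le> g (\<tau> (k0 + k) + u)})"
  have shifted: "continuous_on S (\<lambda>u. g (\<tau> k + u))" for S k
    by (rule continuous_on_compose2[OF g]) (auto intro!: continuous_intros)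
  have "closed (A k)" for k
    unfolding A_def by (intro continuous_on_closed_Collect_le continuous_on_const shifted) auto
  then have A: "A k \<in> lmeasurable" for k
    by (intro lmeasurable_compact) (auto simp: compact_eq_bounded_closed A_def intro: bounded_subset[of "{0..1}"])
  have A_le: "measure lebesgue (A k) \<le> integral {\<tau> (k0 + k)..\<tau> (k0 + k) + 1} g" for k
  proof -
    have AI: "A k \<inter> {0..1} = A k" by (auto simp: A_def)
    have "measure lebesgue (A k) = integral {0..1} (indicat_real (A k))"
      using integral_indicator[of "A k" "{0..1}"] A by (simp add: AI)
    also have "\<dots> \<le> integral {0..1} (\<lambda>u. g (\<tau> (k0 + k) + u))"
    proof (rule integral_le)
      show "indicat_real (A k) integrable_on {0..1::real}"
        using A by (simp add: integrable_on_indicator AI)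
      show "indicat_real (A k) u \<le> g (\<tau> (k0 + k) + u)" for u
        using g0 by (auto simp: A_def indicator_def)
    qed (intro integrable_continuous_real shifted)
    also have "\<dots> = integral {\<tau> (k0 + k)..\<tau> (k0 + k) + 1} g"
      using integral_shift_Icc_real[of 0 1 g "\<tau> (k0 + k)"] by (simp add: o_def add.commute)
    finally show ?thesis .
  qed
  have "(\<Sum>k<n. measure lebesgue (A k)) \<le> integral {s..\<tau> (k0 + n)} g" for n
  proof (induction n)
    case 0
    then show ?case by (simp add: integral_nonneg gI g0)
  next
    case (Suc n)
    have "(\<Sum>k<Suc n. measure lebesgue (A k))
        \<le> integral {s..\<tau> (k0 + n)} g + integral {\<tau> (k0 + n)..\<tau> (k0 + n) + 1} g"
      using Suc A_le[of n] by simp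
    also have "\<dots> = integral {s..\<tau> (k0 + n) + 1} g"
      by (rule Henstock_Kurzweil_Integration.integral_combine[OF k0]) (auto intro: gI)
    also have "\<dots> \<le> integral {s..\<tau> (k0 + Suc n)} g"
      using \<tau>[of "k0 + n"] by (intro integral_subset_le gI) (auto intro: g0)
    finally show ?case .
  qed
  then have "summable (\<lambda>k. measure lebesgue (A k))"
    using bound[OF k0] by (intro summableI_nonneg_bounded[where x = M]) (auto intro: order_trans)
  then have "AE u in lebesgue. \<forall>\<^sub>F k in sequentially. u \<in> space lebesgue - A k"
  proof (rule borel_cantelli_AE1[rotated 2])
    show "A k \<in> sets lebesgue" "emeasure lebesgue (A k) < \<infinity>" for k
      using A[of k] by (simp_all only: fmeasurable_def mem_Collect_eq infinity_ennreal_def)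
  qed
  with often have "AE u in lebesgue. u \<notin> {0..1::real}"
  proof eventually_elim
    case (elim u)
    show ?case
    proof
      assume u: "u \<in> {0..1}"
      obtain N where N: "\<And>k. N \<le> k \<Longrightarrow> u \<notin> A k"
        using elim(2) by (auto simp: eventually_sequentially)
      obtain k where "k0 + N \<le> k" "1 \<le> g (\<tau> k + u)" using elim(1) u by blast
      then have "N \<le> k - k0" "u \<in> A (k - k0)" using u by (auto simp: A_def)
      with N show False by blast
    qed
  qed
  then have "{0..1::real} \<in> null_sets lebesgue" by (simp add: AE_iff_null_sets)
  then show False by (simp add: null_sets_def)
qed

text \<open>
For each fixed offset \<open>u\<close> in the unit interval, almost every path satisfies
\<open>0 \<le> c * \<omega> (\<tau> k + u)\<close> for infinitely many \<open>k\<close>. Joint measurability and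
Fubini's theorem exchange the quantifiers: almost every path has this property for almost every
\<open>u\<close>, and the exponential is then at least \<open>1\<close> often enough for its integral to diverge.
\<close>

proposition wiener_exponential_functional_diverges:
  assumes P: "two_sided_wiener_space P"
  shows "AE \<omega> in P. \<forall>s M. \<exists>t\<ge>s. M \<le> integral {s..t} (\<lambda>r. exp (c * \<omega> r))"
proof -
  interpret prob_space P by (rule wiener_prob_space[OF P])
  interpret pair_sigma_finite lborel P ..
  \<comment> \<open>Faster than geometric growth makes the ratios \<tau> k / (\<tau> (Suc k) - \<tau> k) summable; they are at
    most 1 / 4 ^ k. For the shifted times \<tau> k + u with u \<le> 1 \<le> \<tau> k the bound doubles.\<close>
  define \<tau> :: "nat \<Rightarrow> real" where "\<tau> = (\<lambda>k. 2 ^ (k * k))"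
  have \<tau>_pos: "1 \<le> \<tau> k" for k by (simp add: \<tau>_def)
  have \<tau>_Suc: "\<tau> (Suc k) = \<tau> k * (2 * 4 ^ k)" for k
  proof -
    have "Suc k * Suc k = k * k + (1 + 2 * k)" by simp
    moreover have "(2::real) ^ (2 * k) = 4 ^ k" by (simp add: power_mult)
    ultimately show ?thesis by (simp only: \<tau>_def power_add) simp
  qed
  have gap: "4 ^ k \<le> \<tau> k * 4 ^ k" "\<tau> k * 4 ^ k \<le> \<tau> (Suc k) - \<tau> k" for k
  proof -
    show "4 ^ k \<le> \<tau> k * 4 ^ k" using \<tau>_pos[of k] by simp
    have "\<tau> k * 1 \<le> \<tau> k * 4 ^ k" using \<tau>_pos[of k] by (intro mult_left_mono) auto
    then show "\<tau> k * 4 ^ k \<le> \<tau> (Suc k) - \<tau> k" by (simp add: \<tau>_Suc)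
  qed
  have step: "\<tau> k + 1 \<le> \<tau> (Suc k)" for k
    using gap[of k] one_le_power[of "4::real" k] by linarith
  have at_u: "AE \<omega> in P. \<forall>n. \<exists>k\<ge>n. 0 \<le> c * \<omega> (\<tau> k + u)" if u: "u \<in> {0..1}" for u
  proof (cases "c = 0")
    case False
    show ?thesis
    proof (rule wiener_nonneg_infinitely_often[OF P False])
      show "strict_mono (\<lambda>k. \<tau> k + u)"
        unfolding strict_mono_Suc_iff
      proof
        show "\<tau> k + u < \<tau> (Suc k) + u" for k using step[of k] by simp
      qed
      show "0 < \<tau> 0 + u" using \<tau>_pos[of 0] u by simp
      show "summable (\<lambda>k. (\<tau> k + u) / (\<tau> (Suc k) + u - (\<tau> k + u)))"
      proof (rule summable_comparison_test'[of "\<lambda>k. 2 * (1 / 4) ^ k" 0])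
        show "summable (\<lambda>k. 2 * (1 / 4) ^ k :: real)" by (intro summable_mult summable_geometric) simp
        fix k
        have pos: "0 < \<tau> k * 4 ^ k" using \<tau>_pos[of k] by (intro mult_pos_pos) auto
        have "(\<tau> k + u) / (\<tau> (Suc k) - \<tau> k) \<le> (2 * \<tau> k) / (\<tau> k * 4 ^ k)"
          using gap(2)[of k] pos \<tau>_pos[of k] u by (intro frac_le) auto
        also have "\<dots> = 2 * (1 / 4) ^ k"
          using \<tau>_pos[of k] by (simp add: power_one_over)
        finally show "norm ((\<tau> k + u) / (\<tau> (Suc k) + u - (\<tau> k + u))) \<le> 2 * (1 / 4) ^ k"
          using \<tau>_pos[of k] u step[of k] by simp
      qed
    qed
  qed auto
  have [measurable]: "(\<lambda>x. snd x (\<tau> k + fst x)) \<in> borel_measurable (lborel \<Otimes>\<^sub>M P)" for k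
  proof -
    have "(\<lambda>x. (\<tau> k + fst x, snd x)) \<in> lborel \<Otimes>\<^sub>M P \<rightarrow>\<^sub>M borel \<Otimes>\<^sub>M P" by measurable
    from measurable_compose[OF this wiener_jointly_measurable[OF P]] show ?thesis by simp
  qed
  have "AE u in lborel. AE \<omega> in P. u \<in> {0..1} \<longrightarrow> (\<forall>n. \<exists>k\<ge>n. 0 \<le> c * \<omega> (\<tau> k + u))"
  proof (rule AE_I2)
    show "AE \<omega> in P. u \<in> {0..1} \<longrightarrow> (\<forall>n. \<exists>k\<ge>n. 0 \<le> c * \<omega> (\<tau> k + u))" for u
      using at_u[of u] by (cases "u \<in> {0..1}") simp_all
  qed
  then have "AE \<omega> in P. AE u in lborel. u \<in> {0..1} \<longrightarrow> (\<forall>n. \<exists>k\<ge>n. 0 \<le> c * \<omega> (\<tau> k + u))"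
    by (subst (asm) AE_commute) measurable
  then show ?thesis
    using AE_space
  proof eventually_elim
    case (elim \<omega>)
    have "continuous_on UNIV \<omega>" using elim(2) wiener_space[OF P] by (simp add: wiener_paths_def)
    then have "continuous_on UNIV (\<lambda>r. exp (c * \<omega> r))" by (intro continuous_intros)
    moreover have "AE u in lebesgue. u \<in> {0..1} \<longrightarrow> (\<forall>n. \<exists>k\<ge>n. 1 \<le> exp (c * \<omega> (\<tau> k + u)))"
      using AE_completion[OF elim(1)] by simp
    ultimately show ?case
      using step by (intro allI integral_unbounded_if_often_large) auto
  qed
qed

section \<open>Decay of the transformed flow\<close>

text \<open>
Right-continuity gives bounds only on intervals to the right of a point. A right-continuous function
may be unbounded to the left of a point, and hence on a compact interval, so the integrability of the
drift below is obtained only on short intervals that start at a given time.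
\<close>

lemma right_continuous_bounded_right:
  assumes "right_continuous g"
  obtains \<delta> M where "0 < \<delta>" "\<And>r. t \<le> r \<Longrightarrow> r \<le> t + \<delta> \<Longrightarrow> \<bar>g r\<bar> \<le> M"
proof -
  have "(g \<longlongrightarrow> g t) (at_right t)"
    using assms by (simp add: right_continuous_def continuous_within)
  then have "\<forall>\<^sub>F r in at_right t. dist (g r) (g t) < 1"
    by (rule tendstoD) simp
  then obtain b where b: "t < b" "\<And>r. t < r \<Longrightarrow> r < b \<Longrightarrow> dist (g r) (g t) < 1"
    unfolding eventually_at_right_field by blast
  have "\<bar>g r\<bar> \<le> \<bar>g t\<bar> + 1" if "t \<le> r" "r \<le> t + (b - t) / 2" for r
  proof (cases "r = t")
    case False
    then have "dist (g r) (g t) < 1" using that b(1) by (intro b(2)) (auto simp: field_simps)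
    then show ?thesis by (simp add: dist_real_def)
  qed simp
  with b(1) show thesis using that[of "(b - t) / 2" "\<bar>g t\<bar> + 1"] by auto
qed

lemma gelfand_pairing_bilinear:
  assumes "gelfand_triple j D"
  shows "bounded_bilinear (\<lambda>w v. blinfun_apply (D w) v)"
    and "\<bar>blinfun_apply (D w) v\<bar> \<le> norm w * norm v"
proof -
  have D: "linear D" "\<And>w. norm (D w) = norm w" using assms by (auto simp: gelfand_triple_def)
  have le: "\<bar>blinfun_apply (D w) v\<bar> \<le> norm w * norm v" for w v
    using norm_blinfun[of "D w" v] by (simp add: D(2))
  then show "\<bar>blinfun_apply (D w) v\<bar> \<le> norm w * norm v" .
  show "bounded_bilinear (\<lambda>w v. blinfun_apply (D w) v)"
  proof
    show "\<exists>K. \<forall>a b. norm (blinfun_apply (D a) b) \<le> norm a * norm b * K"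
      by (rule exI[of _ 1]) (simp add: le)
  qed (simp_all add: linear_add[OF D(1)] linear_scale[OF D(1)] blinfun.add_left blinfun.scaleR_left
      blinfun.add_right blinfun.scaleR_right)
qed

lemma gelfand_H_in_dual_apply:
  assumes "gelfand_triple j D"
  shows "blinfun_apply (D (H_in_dual j D h)) x = inner h (j x)"
proof -
  have "surj D" "bounded_linear j" using assms by (auto simp: gelfand_triple_def)
  moreover from this(2) have "bounded_linear (\<lambda>v. inner h (j v))"
    by (intro bounded_linear_compose[OF bounded_linear_inner_right])
  ultimately show ?thesis by (simp add: H_in_dual_def surj_f_inv_f bounded_linear_Blinfun_apply)
qed

text \<open>
The equation at the initial time only says that \<open>z s\<close> and \<open>x\<close> define the same functional on
the smaller space; since that space is dense, they are equal.
\<close>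

lemma solution_initial_value:
  assumes triple: "gelfand_triple j D" and sol: "is_solution j D \<alpha> \<mu> A \<omega> s x z"
  shows "z s = x"
proof -
  have "(LINT r:{s..s}|lebesgue. transformed_drift j \<mu> A \<omega> r (z r)) = 0"
    unfolding set_lebesgue_integral_def
  proof (rule integral_eq_zero_AE)
    have "{s} \<in> null_sets lebesgue" by (simp flip: negligible_iff_null_sets)
    then show "AE r in lebesgue. indicat_real {s..s} r *\<^sub>R transformed_drift j \<mu> A \<omega> r (z r) = 0"
      by (rule AE_mp[OF AE_not_in]) (simp add: indicator_def)
  qed
  then have "H_in_dual j D (z s) = H_in_dual j D x"
    using sol by (simp add: is_solution_def)
  then have "inner (z s) (j v) = inner x (j v)" for v
    by (metis gelfand_H_in_dual_apply[OF triple])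
  then have "range j \<subseteq> {h. inner (z s - x) h = 0}" by (auto simp: inner_diff_left)
  moreover have "closed {h. inner (z s - x) h = 0}"
    by (intro closed_Collect_eq continuous_intros)
  ultimately have "closure (range j) \<subseteq> {h. inner (z s - x) h = 0}"
    by (rule closure_minimal)
  moreover have "z s - x \<in> closure (range j)"
    using triple by (simp add: gelfand_triple_def)
  ultimately have "inner (z s - x) (z s - x) = 0" by blast
  then show ?thesis by simp
qed

text \<open>
Pairing the integral equation in the dual with a fixed vector gives a scalar equation. Bounded
functionals commute with the Bochner integral, so the rest of the argument needs scalar integrals only.
\<close>

lemma solution_increment:
  assumes triple: "gelfand_triple j D" and sol: "is_solution j D \<alpha> \<mu> A \<omega> s x z"
    and rt: "s \<le> r" "r \<le> t"
  shows "inner (z t - z r) (j v) = integral {r..t} (\<lambda>\<tau>. blinfun_apply (D (transformed_drift j \<mu> A \<omega> \<tau> (z \<tau>))) v)"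
proof -
  define u where "u = (\<lambda>\<tau>. transformed_drift j \<mu> A \<omega> \<tau> (z \<tau>))"
  interpret B: bounded_bilinear "\<lambda>w v. blinfun_apply (D w) v"
    by (rule gelfand_pairing_bilinear(1)[OF triple])
  have I: "set_integrable lebesgue {s..t'} u"
    and eq: "H_in_dual j D (z t') = H_in_dual j D x + (LINT \<tau>:{s..t'}|lebesgue. u \<tau>)" if "s \<le> t'" for t'
    using sol that by (auto simp: is_solution_def u_def)
  have val: "inner (z t') (j v) = inner x (j v) + integral {s..t'} (\<lambda>\<tau>. blinfun_apply (D (u \<tau>)) v)"
    and ai: "(\<lambda>\<tau>. blinfun_apply (D (u \<tau>)) v) absolutely_integrable_on {s..t'}" if "s \<le> t'" for t'
  proof -
    have ind: "blinfun_apply (D (indicator S \<tau> *\<^sub>R u \<tau>)) v = indicator S \<tau> *\<^sub>R blinfun_apply (D (u \<tau>)) v" for S \<tau>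
      by (rule B.scaleR_left)
    show ai: "(\<lambda>\<tau>. blinfun_apply (D (u \<tau>)) v) absolutely_integrable_on {s..t'}"
      using integrable_bounded_linear[OF B.bounded_linear_left[of v] I[OF that, unfolded set_integrable_def]]
      by (simp only: set_integrable_def ind)
    have "inner (z t') (j v) = blinfun_apply (D (H_in_dual j D (z t'))) v"
      by (simp add: gelfand_H_in_dual_apply[OF triple])
    also have "\<dots> = inner x (j v) + blinfun_apply (D (LINT \<tau>:{s..t'}|lebesgue. u \<tau>)) v"
      by (simp add: eq[OF that] B.add_left gelfand_H_in_dual_apply[OF triple])
    also have "blinfun_apply (D (LINT \<tau>:{s..t'}|lebesgue. u \<tau>)) v
        = (LINT \<tau>:{s..t'}|lebesgue. blinfun_apply (D (u \<tau>)) v)"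
      unfolding set_lebesgue_integral_def
      using integral_bounded_linear[OF B.bounded_linear_left[of v] I[OF that, unfolded set_integrable_def]]
      by (simp only: ind)
    also have "\<dots> = integral {s..t'} (\<lambda>\<tau>. blinfun_apply (D (u \<tau>)) v)"
      by (rule set_lebesgue_integral_eq_integral(2)[OF ai])
    finally show "inner (z t') (j v) = inner x (j v) + integral {s..t'} (\<lambda>\<tau>. blinfun_apply (D (u \<tau>)) v)" .
  qed
  have "integral {r..t} (\<lambda>\<tau>. blinfun_apply (D (u \<tau>)) v)
      = integral {s..t} (\<lambda>\<tau>. blinfun_apply (D (u \<tau>)) v) - integral {s..r} (\<lambda>\<tau>. blinfun_apply (D (u \<tau>)) v)"
    using rt by (intro integral_as_primitive_difference[OF set_lebesgue_integral_eq_integral(1)[OF ai[of t]]]) auto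
  then show ?thesis
    using val[of t] val[of r] rt by (simp add: u_def inner_diff_left)
qed

lemma transformed_drift_on_range:
  assumes "gelfand_triple j D" "h = j v"
  shows "transformed_drift j \<mu> A \<omega> r h
     = noise_factor \<mu> \<omega> r *\<^sub>R A r (inverse (noise_factor \<mu> \<omega> r) *\<^sub>R v) \<omega>"
proof -
  have j: "linear j" "inj j" using assms(1) by (auto simp: gelfand_triple_def bounded_linear.linear)
  have "inverse (noise_factor \<mu> \<omega> r) *\<^sub>R h = j (inverse (noise_factor \<mu> \<omega> r) *\<^sub>R v)"
    by (simp add: assms(2) linear_scale[OF j(1)])
  then show ?thesis
    by (simp add: transformed_drift_def extend_by_zero_def inv_f_f[OF j(2)])
qed

text \<open>
The scaling by the noise factor \<open>m\<close> turns the bound for the drift into one with the weight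
\<open>m powr (2 - p)\<close>: one factor \<open>m\<close> stands in front of the drift, a second one arises from
writing the test vector as \<open>m\<close> times the argument of the drift, and the norm of that argument
contributes \<open>m powr (- p)\<close>.
\<close>

lemma transformed_drift_dissipative:
  assumes triple: "gelfand_triple j D" and h: "h = j v"
    and diss: "\<And>v. blinfun_apply (D (A r v \<omega>)) v \<le> - l * norm (j v) powr p"
  shows "blinfun_apply (D (transformed_drift j \<mu> A \<omega> r h)) v
     \<le> - (l * exp ((p - 2) * \<mu> * \<omega> r) * norm h powr p)"
proof -
  define m where "m = noise_factor \<mu> \<omega> r"
  have m: "0 < m" by (simp add: m_def noise_factor_def)
  have j: "linear j" using triple by (auto simp: gelfand_triple_def bounded_linear.linear)
  have D: "linear D" using triple by (auto simp: gelfand_triple_def)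
  define w where "w = inverse m *\<^sub>R v"
  have v: "v = m *\<^sub>R w" using m by (simp add: w_def)
  have "blinfun_apply (D (transformed_drift j \<mu> A \<omega> r h)) v = m * (m * blinfun_apply (D (A r w \<omega>)) w)"
    unfolding transformed_drift_on_range[OF triple h] m_def[symmetric] w_def[symmetric]
    by (subst v) (simp add: linear_scale[OF D] blinfun.scaleR_left blinfun.scaleR_right)
  also have "\<dots> \<le> m * (m * (- l * norm (j w) powr p))"
    using m diss[of w] by (intro mult_left_mono) auto
  also have "norm (j w) = norm h / m"
    using m by (simp add: w_def h linear_scale[OF j] divide_inverse mult.commute)
  also have "m * (m * (- l * (norm h / m) powr p)) = - (l * (m powr 1 * m powr 1 * m powr (- p)) * norm h powr p)"
  proof -
    have "(norm h / m) powr p = norm h powr p * m powr (- p)"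
      using m by (simp add: powr_divide powr_minus_divide)
    then show ?thesis using m by (simp add: mult_ac)
  qed
  also have "m powr 1 * m powr 1 * m powr (- p) = m powr (2 - p)"
    unfolding powr_add[symmetric] by simp
  also have "\<dots> = exp ((p - 2) * \<mu> * \<omega> r)"
    by (simp add: m_def noise_factor_def powr_def algebra_simps)
  finally show ?thesis .
qed

lemma noise_factor_continuous:
  assumes "\<omega> \<in> wiener_paths"
  shows "continuous_on S (noise_factor \<mu> \<omega>)"
proof -
  have "continuous_on S \<omega>"
    using assms by (auto simp: wiener_paths_def intro: continuous_on_subset)
  then show ?thesis unfolding noise_factor_def by (intro continuous_intros)
qed

text \<open>
The growth condition bounds the \<open>q\<close>-th power of the norm of the drift, with the conjugate exponent
\<open>q = \<alpha> / (\<alpha> - 1)\<close>, by an integrable function as soon as the coefficients are bounded.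
The noise factor and its inverse are bounded by continuity of the path.
\<close>

lemma solution_drift_locally_integrable:
  assumes triple: "gelfand_triple j D" and alpha: "1 < \<alpha>"
    and C1: "\<And>\<tau>. \<tau> \<in> {t..T} \<Longrightarrow> \<bar>C1 \<tau> \<omega>\<bar> \<le> M1" and C2: "\<And>\<tau>. \<tau> \<in> {t..T} \<Longrightarrow> \<bar>C2 \<tau> \<omega>\<bar> \<le> M2"
    and f: "L1_loc (\<lambda>t. f t \<omega>)" and A4: "condition_A4 j A \<alpha> C1 C2 f"
    and \<omega>: "\<omega> \<in> wiener_paths" and z: "continuous_on {t..T} z"
    and zv: "AE \<tau> in lebesgue. \<tau> \<in> {t..T} \<longrightarrow> z \<tau> = j (v \<tau>)"
    and vp: "(\<lambda>\<tau>. norm (v \<tau>) powr \<alpha>) absolutely_integrable_on {t..T}"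
    and u: "set_borel_measurable lebesgue {t..T} (\<lambda>\<tau>. transformed_drift j \<mu> A \<omega> \<tau> (z \<tau>))"
  shows "(\<lambda>\<tau>. norm (transformed_drift j \<mu> A \<omega> \<tau> (z \<tau>)) powr (\<alpha> / (\<alpha> - 1))) absolutely_integrable_on {t..T}"
proof (cases "t \<le> T")
  case True
  define q where "q = \<alpha> / (\<alpha> - 1)"
  have q: "0 < q" using alpha by (simp add: q_def)
  define m where "m = noise_factor \<mu> \<omega>"
  have m: "0 < m \<tau>" for \<tau> by (simp add: m_def noise_factor_def)
  define U where "U = (\<lambda>\<tau>. transformed_drift j \<mu> A \<omega> \<tau> (z \<tau>))"
  have mc: "continuous_on {t..T} m" unfolding m_def by (rule noise_factor_continuous[OF \<omega>])
  then have "continuous_on {t..T} (\<lambda>\<tau>. inverse (m \<tau>))"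
    by (intro continuous_intros) (use m in \<open>auto simp: less_imp_neq[symmetric]\<close>)
  with mc have "bounded (m ` {t..T})" "bounded ((\<lambda>\<tau>. inverse (m \<tau>)) ` {t..T})"
    by (auto intro!: compact_imp_bounded compact_continuous_image)
  then obtain K1 K2 where "\<forall>\<tau>\<in>{t..T}. \<bar>m \<tau>\<bar> \<le> K1" "\<forall>\<tau>\<in>{t..T}. \<bar>inverse (m \<tau>)\<bar> \<le> K2"
    unfolding bounded_iff by auto
  then have K: "m \<tau> \<le> K1" "inverse (m \<tau>) \<le> K2" if "\<tau> \<in> {t..T}" for \<tau>
    using that by (auto dest!: bspec intro: abs_le_D1)
  have M: "0 \<le> M1" "0 \<le> M2" using C1[of t] C2[of t] True by force+
  have m0: "0 \<le> m t" "0 \<le> inverse (m t)" using m[of t] by simp_all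
  have K0: "0 \<le> K1" "0 \<le> K2"
    using order_trans[OF m0(1) K(1)[of t]] order_trans[OF m0(2) K(2)[of t]] True by simp_all
  define G where "G = (\<lambda>\<tau>. (K1 powr q * M1 * K2\<^sup>2) * (norm (z \<tau>))\<^sup>2
      + ((K1 powr q * M2 * K2 powr \<alpha>) * norm (v \<tau>) powr \<alpha> + (K1 powr q) * \<bar>f \<tau> \<omega>\<bar>))"
  have "(\<lambda>\<tau>. (norm (z \<tau>))\<^sup>2) absolutely_integrable_on {t..T}"
    by (intro absolutely_integrable_continuous_real continuous_intros z)
  moreover have "(\<lambda>\<tau>. \<bar>f \<tau> \<omega>\<bar>) absolutely_integrable_on {t..T}"
    using f by (auto simp: L1_loc_def intro: set_integrable_abs)
  ultimately have G: "G absolutely_integrable_on {t..T}"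
    unfolding G_def by (intro set_integral_add(1) set_integrable_mult_right vp)
  have "(\<lambda>\<tau>. norm (indicator {t..T} \<tau> *\<^sub>R U \<tau>) powr q) \<in> borel_measurable lebesgue"
    using u unfolding set_borel_measurable_def U_def by measurable
  moreover have "norm (indicator {t..T} \<tau> *\<^sub>R U \<tau>) powr q = indicator {t..T} \<tau> *\<^sub>R norm (U \<tau>) powr q" for \<tau>
    by (simp add: indicator_def)
  ultimately have meas: "set_borel_measurable lebesgue {t..T} (\<lambda>\<tau>. norm (U \<tau>) powr q)"
    by (simp only: set_borel_measurable_def)
  have "(\<lambda>\<tau>. norm (U \<tau>) powr q) absolutely_integrable_on {t..T}"
  proof (rule set_integrable_bound[OF G meas])
    show "AE \<tau> in lebesgue. \<tau> \<in> {t..T} \<longrightarrow> norm (norm (U \<tau>) powr q) \<le> norm (G \<tau>)"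
      using zv
    proof eventually_elim
      case (elim \<tau>)
      show ?case
      proof
        assume \<tau>: "\<tau> \<in> {t..T}"
        define w where "w = inverse (m \<tau>) *\<^sub>R v \<tau>"
        have z\<tau>: "z \<tau> = j (v \<tau>)" using elim \<tau> by simp
        have j: "linear j" using triple by (auto simp: gelfand_triple_def bounded_linear.linear)
        have im: "0 \<le> inverse (m \<tau>)" using m[of \<tau>] by simp
        have "norm (U \<tau>) powr q = m \<tau> powr q * norm (A \<tau> w \<omega>) powr q"
          using m[of \<tau>]
          by (simp add: U_def transformed_drift_on_range[OF triple z\<tau>] powr_mult w_def flip: m_def)
        also have "\<dots> \<le> K1 powr q * (M1 * (K2\<^sup>2 * (norm (z \<tau>))\<^sup>2) + M2 * (K2 powr \<alpha> * norm (v \<tau>) powr \<alpha>) + \<bar>f \<tau> \<omega>\<bar>)"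
        proof (intro mult_mono)
          show "m \<tau> powr q \<le> K1 powr q" using q m[of \<tau>] K(1)[OF \<tau>] by (intro powr_mono2) auto
          have "norm (A \<tau> w \<omega>) powr q \<le> C1 \<tau> \<omega> * (norm (j w))\<^sup>2 + C2 \<tau> \<omega> * norm w powr \<alpha> + f \<tau> \<omega>"
            using A4 \<omega> by (simp add: condition_A4_def q_def)
          also have "\<dots> \<le> M1 * (K2\<^sup>2 * (norm (z \<tau>))\<^sup>2) + M2 * (K2 powr \<alpha> * norm (v \<tau>) powr \<alpha>) + \<bar>f \<tau> \<omega>\<bar>"
          proof (intro add_mono mult_mono)
            have "norm (j w) \<le> K2 * norm (z \<tau>)"
              using im K(2)[OF \<tau>] by (simp add: w_def linear_scale[OF j] z\<tau> mult_right_mono)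
            then show "(norm (j w))\<^sup>2 \<le> K2\<^sup>2 * (norm (z \<tau>))\<^sup>2"
              by (simp add: power_mono flip: power_mult_distrib)
            have "norm w \<le> K2 * norm (v \<tau>)"
              using im K(2)[OF \<tau>] by (simp add: w_def mult_right_mono)
            then have "norm w powr \<alpha> \<le> (K2 * norm (v \<tau>)) powr \<alpha>"
              using alpha by (intro powr_mono2) auto
            then show "norm w powr \<alpha> \<le> K2 powr \<alpha> * norm (v \<tau>) powr \<alpha>"
              using K0 by (simp add: powr_mult)
          qed (use C1[OF \<tau>] C2[OF \<tau>] M in auto)
          finally show "norm (A \<tau> w \<omega>) powr q
              \<le> M1 * (K2\<^sup>2 * (norm (z \<tau>))\<^sup>2) + M2 * (K2 powr \<alpha> * norm (v \<tau>) powr \<alpha>) + \<bar>f \<tau> \<omega>\<bar>" .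
        qed auto
        also have "\<dots> = G \<tau>" by (simp add: G_def algebra_simps)
        finally show "norm (norm (U \<tau>) powr q) \<le> norm (G \<tau>)" by simp
      qed
    qed
  qed
  then show ?thesis by (simp add: U_def q_def)
qed (simp add: set_integrable_def)

text \<open>
The energy inequality combined with the dissipativity of the drift, on an interval to the right of
\<open>t\<close> where the coefficients are bounded.
\<close>

lemma solution_energy_decay_locally:
  assumes triple: "gelfand_triple j D" and alpha: "1 < \<alpha>"
    and C1: "right_continuous (\<lambda>t. C1 t \<omega>)" and C2: "right_continuous (\<lambda>t. C2 t \<omega>)"
    and f: "L1_loc (\<lambda>t. f t \<omega>)" and A4: "condition_A4 j A \<alpha> C1 C2 f"
    and \<omega>: "\<omega> \<in> wiener_paths" and p: "0 < p"
    and diss: "\<And>t v. blinfun_apply (D (A t v \<omega>)) v \<le> - l * norm (j v) powr p"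
    and sol: "is_solution j D \<alpha> \<mu> A \<omega> s x z" and st: "s \<le> t"
  shows "\<exists>\<delta>>0. \<forall>a b. t < a \<and> a \<le> b \<and> b \<le> t + \<delta> \<longrightarrow>
    (norm (z b))\<^sup>2 - (norm (z a))\<^sup>2
      \<le> - integral {a..b} (\<lambda>r. 2 * l * exp ((p - 2) * \<mu> * \<omega> r) * norm (z r) powr p)"
proof -
  obtain \<delta>1 M1 where M1: "0 < \<delta>1" "\<And>r. t \<le> r \<Longrightarrow> r \<le> t + \<delta>1 \<Longrightarrow> \<bar>C1 r \<omega>\<bar> \<le> M1"
    using right_continuous_bounded_right[OF C1] by blast
  obtain \<delta>2 M2 where M2: "0 < \<delta>2" "\<And>r. t \<le> r \<Longrightarrow> r \<le> t + \<delta>2 \<Longrightarrow> \<bar>C2 r \<omega>\<bar> \<le> M2"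
    using right_continuous_bounded_right[OF C2] by blast
  define T where "T = t + min \<delta>1 \<delta>2"
  have T: "t < T" using M1 M2 by (simp add: T_def)
  define u where "u = (\<lambda>\<tau>. transformed_drift j \<mu> A \<omega> \<tau> (z \<tau>))"
  obtain v where v: "v \<in> L_loc \<alpha> s" and zv0: "AE r in lebesgue. s \<le> r \<longrightarrow> z r = j (v r)"
    using sol by (auto simp: is_solution_def)
  have zv: "AE r in lebesgue. r \<in> {t..T} \<longrightarrow> z r = j (v r)"
    using zv0 by eventually_elim (use st in auto)
  have z: "continuous_on {t..T} z"
    using sol st by (auto simp: is_solution_def intro: continuous_on_subset)
  have restr: "set_borel_measurable lebesgue {t..T} g" if "set_borel_measurable lebesgue S g" "{t..T} \<subseteq> S"
    for S and g :: "real \<Rightarrow> 'z::{real_normed_vector,second_countable_topology}"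
  proof -
    have "(\<lambda>r. indicat_real {t..T} r *\<^sub>R (indicator S r *\<^sub>R g r)) \<in> borel_measurable lebesgue"
      by (rule borel_measurable_scaleR[OF borel_measurable_indicator
            that(1)[unfolded set_borel_measurable_def]]) simp
    moreover have "indicat_real {t..T} r *\<^sub>R (indicator S r *\<^sub>R g r) = indicator {t..T} r *\<^sub>R g r" for r
      using that(2) by (auto simp: indicator_def)
    ultimately show ?thesis by (simp only: set_borel_measurable_def)
  qed
  have vm: "set_borel_measurable lebesgue {t..T} v"
    using v st by (intro restr[of "{s..}"]) (auto simp: L_loc_def)
  have "(\<lambda>r. norm (v r) powr \<alpha>) absolutely_integrable_on {s..T}"
    using v by (auto simp: L_loc_def)
  then have vp: "(\<lambda>r. norm (v r) powr \<alpha>) absolutely_integrable_on {t..T}"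
    by (rule set_integrable_subset) (use st in auto)
  have "set_integrable lebesgue {s..T} u"
    using sol st T by (simp add: is_solution_def u_def)
  then have um: "set_borel_measurable lebesgue {t..T} u"
    using st by (intro restr[of "{s..T}"])
      (auto simp: set_integrable_def set_borel_measurable_def)
  have up: "(\<lambda>r. norm (u r) powr (\<alpha> / (\<alpha> - 1))) absolutely_integrable_on {t..T}"
    unfolding u_def
    by (rule solution_drift_locally_integrable[OF triple alpha _ _ f A4 \<omega> z zv vp um[unfolded u_def]])
      (auto intro: M1(2) M2(2) simp: T_def)
  note pairing = gelfand_pairing_bilinear[OF triple]
  define g where "g = (\<lambda>r. l * exp ((p - 2) * \<mu> * \<omega> r) * norm (z r) powr p)"
  have \<omega>c: "continuous_on S \<omega>" for S
    using \<omega> by (auto simp: wiener_paths_def intro: continuous_on_subset)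
  have "(norm (z b))\<^sup>2 - (norm (z a))\<^sup>2 \<le> - integral {a..b} (\<lambda>r. 2 * l * exp ((p - 2) * \<mu> * \<omega> r) * norm (z r) powr p)"
    if ab: "t < a" "a \<le> b" "b \<le> T" for a b
  proof -
    have zab: "continuous_on {a..b} z" by (rule continuous_on_subset[OF z]) (use ab in auto)
    have gI: "g integrable_on {a..b}"
      unfolding g_def using p
      by (intro integrable_continuous_real continuous_intros continuous_on_powr' \<omega>c zab) auto
    have "(\<lambda>r. blinfun_apply (D (u r)) (v r)) absolutely_integrable_on {t..T}"
      by (rule bilinear_pairing_absolutely_integrable[OF pairing alpha um up vm vp])
    then have BI: "(\<lambda>r. blinfun_apply (D (u r)) (v r)) integrable_on {a..b}"
      by (intro integrable_subinterval_real[OF set_lebesgue_integral_eq_integral(1)]) (use ab in auto)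
    have "(norm (z b))\<^sup>2 - (norm (z a))\<^sup>2 \<le> 2 * integral {a..b} (\<lambda>r. blinfun_apply (D (u r)) (v r))"
    proof (rule energy_inequality[OF pairing alpha um up vm vp z zv _ ab])
      show "inner (z r' - z r) (j y) = integral {r..r'} (\<lambda>\<tau>. blinfun_apply (D (u \<tau>)) y)"
        if "t \<le> r" "r \<le> r'" for r r' y
        unfolding u_def using st that by (intro solution_increment[OF triple sol]) auto
    qed
    also have "integral {a..b} (\<lambda>r. blinfun_apply (D (u r)) (v r)) \<le> integral {a..b} (\<lambda>r. - g r)"
    proof (rule integral_le_AE_lebesgue[OF BI integrable_neg[OF gI]])
      show "AE r in lebesgue. r \<in> {a..b} \<longrightarrow> blinfun_apply (D (u r)) (v r) \<le> - g r"
        using zv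
      proof eventually_elim
        case (elim r)
        show ?case
        proof
          assume "r \<in> {a..b}"
          then have "z r = j (v r)" using elim ab by auto
          from transformed_drift_dissipative[OF triple this, of A r \<omega> l p \<mu>] diss
          show "blinfun_apply (D (u r)) (v r) \<le> - g r" by (simp add: u_def g_def)
        qed
      qed
    qed
    also have "2 * integral {a..b} (\<lambda>r. - g r) = - integral {a..b} (\<lambda>r. 2 * g r)" by simp
    finally show ?thesis by (simp only: g_def mult.assoc)
  qed
  then show ?thesis using T by (intro exI[of _ "T - t"]) auto
qed

text \<open>
The local estimates say that \<open>norm (z r) ^ 2\<close> plus the integral of the decay rate is decreasing
immediately to the right of every time. Since this sum is continuous in \<open>r\<close>, it is decreasing
throughout, even if the lengths of the local intervals have no positive lower bound.
\<close>

lemma solution_energy_decay: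
  assumes triple: "gelfand_triple j D" and alpha: "1 < \<alpha>"
    and C1: "right_continuous (\<lambda>t. C1 t \<omega>)" and C2: "right_continuous (\<lambda>t. C2 t \<omega>)"
    and f: "L1_loc (\<lambda>t. f t \<omega>)" and A4: "condition_A4 j A \<alpha> C1 C2 f"
    and \<omega>: "\<omega> \<in> wiener_paths" and p: "0 < p"
    and diss: "\<And>t v. blinfun_apply (D (A t v \<omega>)) v \<le> - l * norm (j v) powr p"
    and sol: "is_solution j D \<alpha> \<mu> A \<omega> s x z" and ab: "s \<le> a" "a \<le> b"
  shows "(norm (z b))\<^sup>2 - (norm (z a))\<^sup>2
      \<le> - integral {a..b} (\<lambda>r. 2 * l * exp ((p - 2) * \<mu> * \<omega> r) * norm (z r) powr p)"
proof -
  define g where "g = (\<lambda>r. 2 * l * exp ((p - 2) * \<mu> * \<omega> r) * norm (z r) powr p)"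
  have z: "continuous_on {a..b} z"
    using sol ab by (auto simp: is_solution_def intro: continuous_on_subset)
  have \<omega>c: "continuous_on {a..b} \<omega>"
    using \<omega> by (auto simp: wiener_paths_def intro: continuous_on_subset)
  have g: "g integrable_on {a..b}"
    unfolding g_def using p
    by (intro integrable_continuous_real continuous_intros continuous_on_powr' \<omega>c z) auto
  define F where "F = (\<lambda>r. (norm (z r))\<^sup>2 + integral {a..r} g)"
  have F: "continuous_on {a..b} F"
    unfolding F_def by (intro continuous_intros z indefinite_integral_continuous_1 g)
  have "F b \<le> F a"
  proof (rule decreasing_if_locally_right_decreasing[OF F ab(2)])
    fix t assume t: "a \<le> t" "t < b"
    have "s \<le> t" using ab t by simp
    from solution_energy_decay_locally[OF triple alpha C1 C2 f A4 \<omega> p diss sol this, folded g_def]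
    obtain \<delta> where \<delta>: "0 < \<delta>" and decay: "\<And>c d. t < c \<Longrightarrow> c \<le> d \<Longrightarrow> d \<le> t + \<delta> \<Longrightarrow>
        (norm (z d))\<^sup>2 - (norm (z c))\<^sup>2 \<le> - integral {c..d} g"
      by blast
    have "F r \<le> F t" if r: "t \<le> r" "r \<le> t + \<delta>" "r \<le> b" for r
    proof (cases "r = t")
      case False
      \<comment> \<open>The energy estimate compares times strictly after t; the value at t is reached by continuity.\<close>
      have step: "F r \<le> F c" if c: "t < c" "c < r" for c
        using decay[of c r] integral_as_primitive_difference[OF g, of c r] c r t by (simp add: F_def)
      have "continuous_on {t..b} F" by (rule continuous_on_subset[OF F]) (use t in auto)
      then have "(F \<longlongrightarrow> F t) (at_right t)"
        using t by (auto simp: continuous_on_def at_within_Icc_at_right dest: bspec[of _ _ t])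
      moreover have "\<forall>\<^sub>F c in at_right t. F r \<le> F c"
        unfolding eventually_at_right_field using step r False by (intro exI[of _ r]) auto
      ultimately show ?thesis
        by (rule tendsto_lowerbound) simp
    qed simp
    then show "\<exists>\<delta>>0. \<forall>r. t \<le> r \<and> r \<le> t + \<delta> \<and> r \<le> b \<longrightarrow> F r \<le> F t"
      using \<delta> by blast
  qed
  then show ?thesis by (simp add: F_def g_def)
qed

text \<open>
Finite time extinction for \<open>norm (z r) ^ 2\<close>, with \<open>norm (z r) powr p\<close> read as its power
\<open>p / 2\<close>.
\<close>

lemma solution_vanishes:
  assumes triple: "gelfand_triple j D" and alpha: "1 < \<alpha>"
    and C1: "right_continuous (\<lambda>t. C1 t \<omega>)" and C2: "right_continuous (\<lambda>t. C2 t \<omega>)"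
    and f: "L1_loc (\<lambda>t. f t \<omega>)" and A4: "condition_A4 j A \<alpha> C1 C2 f"
    and \<omega>: "\<omega> \<in> wiener_paths" and p: "0 < p" "p < 2" and l: "0 < l"
    and diss: "\<And>t v. blinfun_apply (D (A t v \<omega>)) v \<le> - l * norm (j v) powr p"
    and sol: "is_solution j D \<alpha> \<mu> A \<omega> s x z" and st: "s \<le> t"
    and long: "norm x powr (2 - p) \<le> (2 - p) * l * integral {s..t} (\<lambda>r. exp ((p - 2) * \<mu> * \<omega> r))"
  shows "z t = 0"
proof -
  have sq: "(norm h)\<^sup>2 powr e = norm h powr (2 * e)" for h :: 'b and e
    by (simp add: powr_powr flip: powr_numeral)
  have z: "continuous_on {s..t} z"
    using sol by (auto simp: is_solution_def intro: continuous_on_subset)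
  have \<omega>c: "continuous_on {s..t} \<omega>"
    using \<omega> by (auto simp: wiener_paths_def intro: continuous_on_subset)
  define m where "m = (\<lambda>r. 2 * l * exp ((p - 2) * \<mu> * \<omega> r))"
  have "(norm (z t))\<^sup>2 = 0"
  proof (rule finite_time_extinction[of s t "\<lambda>r. (norm (z r))\<^sup>2" m p, OF _ _ _ _ st p])
    show "continuous_on {s..t} (\<lambda>r. (norm (z r))\<^sup>2)" by (intro continuous_intros z)
    show "continuous_on {s..t} m" unfolding m_def by (intro continuous_intros \<omega>c)
    show "(norm (z b))\<^sup>2 - (norm (z a))\<^sup>2 \<le> - integral {a..b} (\<lambda>r. m r * (norm (z r))\<^sup>2 powr (p / 2))"
      if "s \<le> a" "a \<le> b" for a b
      using solution_energy_decay[OF triple alpha C1 C2 f A4 \<omega> p(1) diss sol that]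
      by (simp add: m_def sq)
    show "(norm (z s))\<^sup>2 powr (1 - p / 2) \<le> (1 - p / 2) * integral {s..t} m"
      using long by (simp add: solution_initial_value[OF triple sol] sq m_def algebra_simps)
  qed (use l in \<open>auto simp: m_def\<close>)
  then show ?thesis by simp
qed

section \<open>Absorption and attraction\<close>

lemma norm_le_set_norm: "bounded B \<Longrightarrow> b \<in> B \<Longrightarrow> norm b \<le> set_norm B"
  unfolding set_norm_def by (rule cSUP_upper) (auto simp: bounded_iff bdd_above_def)

theorem theorem3p12:
  fixes j :: "'v::{banach,second_countable_topology} \<Rightarrow> 'h::{real_inner,banach,second_countable_topology}"
    and D :: "'w::{banach,second_countable_topology} \<Rightarrow> ('v \<Rightarrow>\<^sub>L real)"
    and P :: "path measure"
    and \<mu> \<alpha> p :: real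
    and A :: "real \<Rightarrow> 'v \<Rightarrow> path \<Rightarrow> 'w"
    and C1 C2 c f :: "real \<Rightarrow> path \<Rightarrow> real"
    and Z :: "real \<Rightarrow> real \<Rightarrow> path \<Rightarrow> 'h \<Rightarrow> 'h"
    and l :: "path \<Rightarrow> real"
  assumes triple: "gelfand_triple j D"
    and wiener: "two_sided_wiener_space P"
    and alpha: "1 < \<alpha>" "\<alpha> < 2"
    and coeff: "\<And>\<omega>. \<omega> \<in> wiener_paths \<Longrightarrow> right_continuous (\<lambda>t. C1 t \<omega>)"
      "\<And>\<omega>. \<omega> \<in> wiener_paths \<Longrightarrow> right_continuous (\<lambda>t. C2 t \<omega>)"
      "\<And>\<omega>. \<omega> \<in> wiener_paths \<Longrightarrow> right_continuous (\<lambda>t. c t \<omega>)"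
      "\<And>t \<omega>. \<omega> \<in> wiener_paths \<Longrightarrow> 0 < c t \<omega>"
      "\<And>\<omega>. \<omega> \<in> wiener_paths \<Longrightarrow> L1_loc (\<lambda>t. f t \<omega>)"
    and A_pathwise_meas: "\<And>\<omega>. \<omega> \<in> wiener_paths \<Longrightarrow>
      (\<lambda>(t, v). A t v \<omega>) \<in> measurable (borel \<Otimes>\<^sub>M borel) borel"
    and A_meas: "(\<lambda>(t, v, \<omega>). A t v \<omega>) \<in> measurable (borel \<Otimes>\<^sub>M (borel \<Otimes>\<^sub>M P)) borel"
    and stationary: "strictly_stationary A"
    and A1: "condition_A1 D A"
    and A2: "condition_A2 j D A C2"
    and A3: "condition_A3 j D A \<alpha> C1 c f"
    and A4: "condition_A4 j A \<alpha> C1 C2 f"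
    and Z: "solution_family j D \<alpha> \<mu> A Z"
    and p: "0 < p" "p < 2"
    and l_pos: "\<And>\<omega>. \<omega> \<in> wiener_paths \<Longrightarrow> 0 < l \<omega>"
    and dissipative: "\<And>t v \<omega>. \<omega> \<in> wiener_paths \<Longrightarrow>
      D (A t v \<omega>) v \<le> - l \<omega> * norm (j v) powr p"
  shows "(\<exists>t0 :: real \<Rightarrow> real \<Rightarrow> path \<Rightarrow> real. AE \<omega> in P. \<forall>B s. bounded B \<longrightarrow>
            s \<le> t0 (set_norm B) s \<omega> \<and>
            (\<forall>t \<ge> t0 (set_norm B) s \<omega>. stoch_flow \<mu> Z t s \<omega> ` B \<subseteq> {0}) \<and>
            (\<forall>t \<ge> t0 (set_norm B) 0 \<omega>. cocycle \<mu> Z t \<omega> ` B \<subseteq> {0}))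
       \<and> ((\<forall>t. \<forall>\<omega>\<in>wiener_paths. A t 0 \<omega> = 0) \<longrightarrow>
            invariant_under P wiener_shift (cocycle \<mu> Z) (\<lambda>_. {0}) \<and>
            forward_attractor P wiener_shift (cocycle \<mu> Z) (\<lambda>_. {0}))"
proof (intro conjI impI)
  define S where "S = stoch_flow \<mu> Z"
  define e where "e = (\<lambda>(\<omega>::path) r. exp ((p - 2) * \<mu> * \<omega> r))"
  have sp: "space P = wiener_paths" by (rule wiener_space[OF wiener])
  have vanish: "S t s \<omega> x = 0"
    if \<omega>: "\<omega> \<in> wiener_paths" and st: "s \<le> t"
      and long: "(noise_factor \<mu> \<omega> s * norm x) powr (2 - p) \<le> (2 - p) * l \<omega> * integral {s..t} (e \<omega>)"
    for \<omega> s t x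
  proof -
    have "is_solution j D \<alpha> \<mu> A \<omega> s (noise_factor \<mu> \<omega> s *\<^sub>R x) (\<lambda>t. Z t s \<omega> (noise_factor \<mu> \<omega> s *\<^sub>R x))"
      using Z \<omega> by (auto simp: solution_family_def)
    from solution_vanishes[where ?C1.0 = C1 and ?C2.0 = C2 and f = f and A = A and \<omega> = \<omega>,
        OF triple alpha(1) coeff(1,2,5)[OF \<omega>] A4 \<omega> p l_pos[OF \<omega>] dissipative[OF \<omega>] this st]
    have "Z t s \<omega> (noise_factor \<mu> \<omega> s *\<^sub>R x) = 0"
      using long by (simp add: e_def noise_factor_def)
    then show ?thesis by (simp add: S_def stoch_flow_def)
  qed
  have e_int: "e \<omega> integrable_on {a..b}" if "\<omega> \<in> wiener_paths" for \<omega> a b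
    using that unfolding e_def wiener_paths_def
    by (intro integrable_continuous_real continuous_intros) (auto intro: continuous_on_subset)
  define absorbed where
    "absorbed = (\<lambda>R s \<omega> t. s \<le> t \<and> (\<forall>t'\<ge>t. \<forall>x. norm x \<le> R \<longrightarrow> S t' s \<omega> x = 0))"
  \<comment> \<open>One absorption time per radius R is chosen for all initial values of norm at most R together.\<close>
  define t0 where "t0 = (\<lambda>R s \<omega>. SOME t. absorbed R s \<omega> t)"
  have "AE \<omega> in P. \<forall>R s. absorbed R s \<omega> (t0 R s \<omega>)"
    using wiener_exponential_functional_diverges[OF wiener, of "(p - 2) * \<mu>"] AE_space
  proof eventually_elim
    case (elim \<omega>)
    then have \<omega>: "\<omega> \<in> wiener_paths" by (simp add: sp)
    have "\<exists>t. absorbed R s \<omega> t" for R s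
    proof -
      define M where "M = (noise_factor \<mu> \<omega> s * R) powr (2 - p) / ((2 - p) * l \<omega>)"
      obtain t where t: "s \<le> t" "M \<le> integral {s..t} (e \<omega>)"
        using elim(1) unfolding e_def by blast
      have "S t' s \<omega> x = 0" if t': "t \<le> t'" and x: "norm x \<le> R" for t' x
      proof (rule vanish[OF \<omega>])
        show "s \<le> t'" using t t' by simp
        have "(noise_factor \<mu> \<omega> s * norm x) powr (2 - p) \<le> (noise_factor \<mu> \<omega> s * R) powr (2 - p)"
          using x p by (intro powr_mono2 mult_left_mono mult_nonneg_nonneg) (auto simp: noise_factor_def)
        also have "\<dots> = (2 - p) * l \<omega> * M" using p l_pos[OF \<omega>] by (simp add: M_def)
        also have "\<dots> \<le> (2 - p) * l \<omega> * integral {s..t} (e \<omega>)"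
          using t p l_pos[OF \<omega>] by (intro mult_left_mono) auto
        also have "\<dots> \<le> (2 - p) * l \<omega> * integral {s..t'} (e \<omega>)"
          using t' p l_pos[OF \<omega>]
          by (intro mult_left_mono integral_subset_le e_int[OF \<omega>]) (auto simp: e_def)
        finally show "(noise_factor \<mu> \<omega> s * norm x) powr (2 - p) \<le> (2 - p) * l \<omega> * integral {s..t'} (e \<omega>)" .
      qed
      with t(1) show ?thesis unfolding absorbed_def by blast
    qed
    then show ?case unfolding t0_def by (metis someI_ex)
  qed
  then have absorbing: "AE \<omega> in P. \<forall>B s. bounded B \<longrightarrow>
            s \<le> t0 (set_norm B) s \<omega> \<and>
            (\<forall>t \<ge> t0 (set_norm B) s \<omega>. stoch_flow \<mu> Z t s \<omega> ` B \<subseteq> {0}) \<and>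
            (\<forall>t \<ge> t0 (set_norm B) 0 \<omega>. cocycle \<mu> Z t \<omega> ` B \<subseteq> {0})"
  proof eventually_elim
    case (elim \<omega>)
    then show ?case
      unfolding absorbed_def S_def cocycle_def using norm_le_set_norm by blast
  qed
  then show "\<exists>t0 :: real \<Rightarrow> real \<Rightarrow> path \<Rightarrow> real. AE \<omega> in P. \<forall>B s. bounded B \<longrightarrow>
            s \<le> t0 (set_norm B) s \<omega> \<and>
            (\<forall>t \<ge> t0 (set_norm B) s \<omega>. stoch_flow \<mu> Z t s \<omega> ` B \<subseteq> {0}) \<and>
            (\<forall>t \<ge> t0 (set_norm B) 0 \<omega>. cocycle \<mu> Z t \<omega> ` B \<subseteq> {0})"
    by blast
  show inv: "invariant_under P wiener_shift (cocycle \<mu> Z) (\<lambda>_. {0})"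
    unfolding invariant_under_def sp
  proof (intro ballI allI impI)
    fix \<omega> :: path and t :: real assume \<omega>: "\<omega> \<in> wiener_paths" and t: "0 \<le> t"
    have "0 \<le> integral {0..t} (e \<omega>)"
      by (rule integral_nonneg[OF e_int[OF \<omega>]]) (simp add: e_def)
    then have "cocycle \<mu> Z t \<omega> 0 = 0"
      using vanish[OF \<omega> t, of 0] p l_pos[OF \<omega>] by (simp add: S_def cocycle_def)
    then show "cocycle \<mu> Z t \<omega> ` {0} = {0}" by simp
  qed
  show "forward_attractor P wiener_shift (cocycle \<mu> Z) (\<lambda>_. {0})"
    unfolding forward_attractor_def
  proof (intro conjI inv)
    show "random_compact_set P (\<lambda>_. {0::'h})" by (simp add: random_compact_set_def)
    show "AE \<omega> in P. \<forall>B. bounded B \<longrightarrow>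
        ((\<lambda>t. SUP b\<in>B. ennreal (infdist (cocycle \<mu> Z t \<omega> b) {0})) \<longlongrightarrow> 0) at_top"
      using absorbing
    proof eventually_elim
      case (elim \<omega>)
      show ?case
      proof (intro allI impI)
        fix B :: "'h set" assume "bounded B"
        then have "\<forall>t \<ge> t0 (set_norm B) 0 \<omega>. cocycle \<mu> Z t \<omega> ` B \<subseteq> {0}" using elim by blast
        then have "(SUP b\<in>B. ennreal (infdist (cocycle \<mu> Z t \<omega> b) {0})) = 0"
          if "t0 (set_norm B) 0 \<omega> \<le> t" for t
          using that by (intro antisym SUP_least) (auto simp: image_subset_iff)
        then have "\<forall>\<^sub>F t in at_top. (SUP b\<in>B. ennreal (infdist (cocycle \<mu> Z t \<omega> b) {0})) = 0"
          unfolding eventually_at_top_linorder by blast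
        then show "((\<lambda>t. SUP b\<in>B. ennreal (infdist (cocycle \<mu> Z t \<omega> b) {0})) \<longlongrightarrow> 0) at_top"
          by (rule tendsto_eventually)
      qed
    qed
  qed
qed

end
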